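(* Let $H=H_1\sqcup H_2$, where $H_1$ and $H_2$ are connected graphs, let $v\notin V(H)$, and let $G=\operatorname{cone}(v,H)$. The following conditions are equivalent: (a) $J_{H_1}$ and $J_{H_2}$ are unmixed; (b) $J_G$ is unmixed.
   Context: All graphs are finite and simple; $\sqcup$ denotes disjoint union of graphs. For a graph $H$ and $v\notin V(H)$, $\operatorname{cone}(v,H)$ is the graph with vertex set $V(H)\cup\{v\}$ and edge set $E(H)\cup\{\{u,v\}:u\in V(H)\}$. Let $K$ be a field. The binomial edge ideal $J_G$ of a graph $G$ is the ideal of the polynomial ring $K[x_i,y_i: i\in V(G)]$ generated by the binomials $x_iy_j-x_jy_i$, where $\{i,j\}\in E(G)$ and $i<j$ (for a fixed total order on $V(G)$). An ideal is unmixed if all its associated primes have the same height (binomial edge ideals are radical, so these are the minimal primes). *)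

theory Defs
  imports
    "HOL-Library.Poly_Mapping"
    "HOL-Library.Extended_Nat"
    "HOL-Algebra.Ideal"
    "Graph_Theory.Graph_Theory"
begin

section \<open>Graphs\<close>

text \<open>
  Finite simple graphs are the \<open>pair_graph\<close>s of the Graph_Theory library: an undirected edge
  \<open>{u, w}\<close> is represented by the two arcs \<open>(u, w)\<close> and \<open>(w, u)\<close>. In that library
  \<open>connected\<close> includes that the vertex set is nonempty.
\<close>

definition graph_union :: "'v pair_pre_digraph \<Rightarrow> 'v pair_pre_digraph \<Rightarrow> 'v pair_pre_digraph" where
  "graph_union G H = \<lparr>pverts = pverts G \<union> pverts H, parcs = parcs G \<union> parcs H\<rparr>"

definition cone :: "'v \<Rightarrow> 'v pair_pre_digraph \<Rightarrow> 'v pair_pre_digraph" where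
  "cone v H = \<lparr>pverts = insert v (pverts H),
               parcs = parcs H \<union> {(u, v) | u. u \<in> pverts H} \<union> {(v, u) | u. u \<in> pverts H}\<rparr>"

lemma pair_graph_iff:
  "pair_graph G \<longleftrightarrow> finite (pverts G) \<and> parcs G \<subseteq> pverts G \<times> pverts G \<and> sym (parcs G)
     \<and> irrefl (parcs G)"
proof
  assume "pair_graph G"
  then interpret pair_graph G .
  show "finite (pverts G) \<and> parcs G \<subseteq> pverts G \<times> pverts G \<and> sym (parcs G) \<and> irrefl (parcs G)"
    using pair_finite_verts arc_fst_in_verts arc_snd_in_verts pair_no_loops pair_sym_arcs
    by (fastforce simp: irrefl_def symmetric_def)
next
  assume G: "finite (pverts G) \<and> parcs G \<subseteq> pverts G \<times> pverts G \<and> sym (parcs G) \<and> irrefl (parcs G)"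
  then have "finite (parcs G)"
    by (meson finite_SigmaI finite_subset)
  with G show "pair_graph G"
    by unfold_locales (auto simp: irrefl_def symmetric_def)
qed

lemma pair_graph_graph_union:
  "pair_graph G \<Longrightarrow> pair_graph H \<Longrightarrow> pair_graph (graph_union G H)"
  unfolding pair_graph_iff graph_union_def by (auto simp: sym_Un irrefl_def)

lemma pair_graph_cone:
  "pair_graph H \<Longrightarrow> v \<notin> pverts H \<Longrightarrow> pair_graph (cone v H)"
  unfolding pair_graph_iff cone_def by (auto simp: sym_def irrefl_def)


section \<open>Associated primes, height and unmixed ideals\<close>

definition associated_primes :: "('a, 'b) ring_scheme \<Rightarrow> 'a set \<Rightarrow> 'a set set" where
  "associated_primes R I =
     {P. primeideal P R \<and> (\<exists>f \<in> carrier R. P = {a \<in> carrier R. a \<otimes>\<^bsub>R\<^esub> f \<in> I})}"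

text \<open>
  The height of a prime ideal \<open>P\<close> is the supremum of the lengths \<open>n\<close> of chains
  \<open>Q 0 \<subset> Q 1 \<subset> \<dots> \<subset> Q n = P\<close> of prime ideals.
\<close>

definition prime_height :: "('a, 'b) ring_scheme \<Rightarrow> 'a set \<Rightarrow> enat" where
  "prime_height R P =
     (SUP n \<in> {n. \<exists>Q :: nat \<Rightarrow> 'a set. (\<forall>i\<le>n. primeideal (Q i) R) \<and> (\<forall>i<n. Q i \<subset> Q (Suc i)) \<and> Q n = P}.
        enat n)"

definition unmixed :: "('a, 'b) ring_scheme \<Rightarrow> 'a set \<Rightarrow> bool" where
  "unmixed R I \<longleftrightarrow>
     (\<forall>P \<in> associated_primes R I. \<forall>Q \<in> associated_primes R I. prime_height R P = prime_height R Q)"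


section \<open>Binomial edge ideals\<close>

datatype 'v indet = X 'v | Y 'v

text \<open>
  Monomials are finitely supported exponent functions and polynomials are finitely supported
  functions from monomials to coefficients, with convolution as multiplication.
\<close>

type_synonym ('v, 'k) mpoly = "('v indet \<Rightarrow>\<^sub>0 nat) \<Rightarrow>\<^sub>0 'k"

definition var :: "'k::field itself \<Rightarrow> 'v indet \<Rightarrow> ('v, 'k) mpoly" where
  "var _ z = Poly_Mapping.single (Poly_Mapping.single z 1) 1"

text \<open>The polynomial ring \<open>K[x\<^sub>i, y\<^sub>i : i \<in> V]\<close>.\<close>

definition poly_ring :: "'k::field itself \<Rightarrow> 'v set \<Rightarrow> ('v, 'k) mpoly ring" where
  "poly_ring K V =
     \<lparr>carrier = {p. \<forall>m \<in> Poly_Mapping.keys p. Poly_Mapping.keys m \<subseteq> X ` V \<union> Y ` V},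
      monoid.mult = (*), one = 1, zero = 0, add = (+)\<rparr>"

definition binomial_edge_ideal ::
  "'k::field itself \<Rightarrow> 'v::linorder pair_pre_digraph \<Rightarrow> ('v, 'k) mpoly set" where
  "binomial_edge_ideal K G =
     Idl\<^bsub>poly_ring K (pverts G)\<^esub>
       {var K (X i) * var K (Y j) - var K (X j) * var K (Y i) | i j. (i, j) \<in> parcs G \<and> i < j}"

lemma cring_poly_ring: "cring (poly_ring K V)"
proof -
  have add: "p + q \<in> carrier (poly_ring K V)"
    if "p \<in> carrier (poly_ring K V)" "q \<in> carrier (poly_ring K V)" for p q
    using that Poly_Mapping.keys_add[of p q] by (auto simp: poly_ring_def)
  have mult: "p * q \<in> carrier (poly_ring K V)"
    if pq: "p \<in> carrier (poly_ring K V)" "q \<in> carrier (poly_ring K V)" for p q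
  proof -
    have "Poly_Mapping.keys m \<subseteq> X ` V \<union> Y ` V" if "m \<in> Poly_Mapping.keys (p * q)" for m
    proof -
      from that Poly_Mapping.keys_mult[of p q] obtain a b
        where ab: "m = a + b" "a \<in> Poly_Mapping.keys p" "b \<in> Poly_Mapping.keys q" by blast
      with pq have "Poly_Mapping.keys a \<union> Poly_Mapping.keys b \<subseteq> X ` V \<union> Y ` V"
        by (simp add: poly_ring_def)
      with ab(1) Poly_Mapping.keys_add[of a b] show ?thesis
        by (metis order_trans)
    qed
    then show ?thesis by (simp add: poly_ring_def)
  qed
  have minus: "- p \<in> carrier (poly_ring K V)" if "p \<in> carrier (poly_ring K V)" for p
    using that by (simp add: poly_ring_def)
  show ?thesis
  proof (rule cringI)
    show "abelian_group (poly_ring K V)"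
    proof (rule abelian_groupI)
      fix p assume "p \<in> carrier (poly_ring K V)"
      then show "\<exists>q \<in> carrier (poly_ring K V). q \<oplus>\<^bsub>poly_ring K V\<^esub> p = \<zero>\<^bsub>poly_ring K V\<^esub>"
        using minus[of p] by (intro bexI[of _ "- p"]) (simp_all add: poly_ring_def)
    next
      fix p q assume "p \<in> carrier (poly_ring K V)" "q \<in> carrier (poly_ring K V)"
      then show "p \<oplus>\<^bsub>poly_ring K V\<^esub> q \<in> carrier (poly_ring K V)"
        using add[of p q] by (simp add: poly_ring_def)
    qed (simp_all add: poly_ring_def add_ac)
    show "comm_monoid (poly_ring K V)"
    proof (rule comm_monoidI)
      fix p q assume "p \<in> carrier (poly_ring K V)" "q \<in> carrier (poly_ring K V)"
      then show "p \<otimes>\<^bsub>poly_ring K V\<^esub> q \<in> carrier (poly_ring K V)"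
        using mult[of p q] by (simp add: poly_ring_def)
    qed (simp_all add: poly_ring_def mult_ac)
  qed (simp_all add: poly_ring_def distrib_right)
qed

lemma ideal_binomial_edge_ideal:
  assumes "pair_graph G"
  shows "ideal (binomial_edge_ideal K G) (poly_ring K (pverts G))"
proof -
  interpret cring "poly_ring K (pverts G)" by (rule cring_poly_ring)
  have "Poly_Mapping.keys m \<subseteq> X ` pverts G \<union> Y ` pverts G"
    if "(i, j) \<in> parcs G"
      and "m \<in> Poly_Mapping.keys (var K (X i) * var K (Y j) - var K (X j) * var K (Y i))" for i j m
  proof -
    from assms that(1) have ij: "i \<in> pverts G" "j \<in> pverts G"
      by (auto simp: pair_graph_iff)
    have "m \<in> {Poly_Mapping.single (X i) 1 + Poly_Mapping.single (Y j) 1,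
               Poly_Mapping.single (X j) 1 + Poly_Mapping.single (Y i) 1}"
      using subsetD[OF keys_diff that(2)]
      by (auto simp: var_def Poly_Mapping.mult_single)
    with ij Poly_Mapping.keys_add show ?thesis
      by (fastforce split: if_splits)
  qed
  then show ?thesis
    unfolding binomial_edge_ideal_def
    by (intro genideal_ideal) (fastforce simp: poly_ring_def)
qed

end

theory Submission
  imports Defs
begin

text \<open>
  Call the exponent of \<open>X i\<close> in a monomial the number of tokens on the vertex \<open>i\<close>, and the sum of the
  exponents of \<open>X i\<close> and \<open>Y i\<close> the number of slots of \<open>i\<close>. Multiplying \<open>x\<^sub>i y\<^sub>j - x\<^sub>j y\<^sub>i\<close> by a monomial
  says that one token moves along the edge \<open>{i, j}\<close> into a free slot, while all numbers of slots
  stay the same. On a connected graph in which each vertex has a slot, tokens can be rearranged at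
  will (\<open>move_along_path\<close>, \<open>equal_weight_congruent\<close>). So two monomials are congruent modulo the
  binomial edge ideal \<open>J\<^sub>G\<close> if they have the same slots and the same number of tokens on each
  component of the subgraph induced on the vertices that have slots, and a polynomial lies in \<open>J\<^sub>G\<close>
  as soon as its coefficients add up to zero over each of these classes.

  For a vertex set \<open>S\<close>, let \<open>P\<^sub>S\<close> (\<open>component_prime\<close>) be the kernel of the map that kills the variables
  of \<open>S\<close> and sends any other monomial to its slots together with its number of tokens on each
  component of \<open>G - S\<close>. The target is a monoid algebra without zero divisors, so \<open>P\<^sub>S\<close> is prime. The
  description above, with \<open>S\<close> the set of vertices without slots, gives \<open>J\<^sub>G = \<Inter>\<^sub>S P\<^sub>S\<close>. If some
  \<open>s \<in> S\<close> has no two neighbours in different components of \<open>G - S\<close>, then \<open>P\<^sub>S\<close> contains the prime of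
  \<open>S - {s}\<close>. Hence it suffices to intersect over the cut sets, those \<open>S\<close> that have no such element.
  Their primes form an antichain, so they are exactly the associated primes of \<open>J\<^sub>G\<close>
  (\<open>associated_primes_binomial_edge_ideal\<close>).

  The height of \<open>P\<^sub>S\<close> is \<open>|V| + |S| - c(S)\<close>, where \<open>c(S)\<close> is the number of components of \<open>G - S\<close>. An
  explicit chain of toric primes shows that it is at least that large. For the other inequality,
  \<open>|V| - |S| + c(S)\<close> of the variables are algebraically independent modulo \<open>P\<^sub>S\<close>; elements chosen one
  from each step of a chain of primes that ends in \<open>P\<^sub>S\<close> would be algebraically independent of
  these variables and of each other, and a polynomial ring in \<open>N\<close> variables contains at most \<open>N\<close>
  algebraically independent elements (\<open>prime_chain_length_le\<close>). Since the empty set is a cut set,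
  \<open>J\<^sub>G\<close> is unmixed if and only if \<open>c(S) = |S| + c(\<emptyset>)\<close> for all cut sets \<open>S\<close>
  (\<open>unmixed_binomial_edge_ideal_iff\<close>).

  This leaves a count. The nonempty cut sets of the cone \<open>G\<close> are the sets \<open>{v} \<union> T\<^sub>1 \<union> T\<^sub>2\<close> with \<open>T\<^sub>i\<close> a cut
  set of \<open>H\<^sub>i\<close>, and \<open>c({v} \<union> T\<^sub>1 \<union> T\<^sub>2) = c(T\<^sub>1) + c(T\<^sub>2)\<close>. So \<open>J\<^sub>G\<close> is unmixed if and only if
  \<open>c(T\<^sub>1) + c(T\<^sub>2) = (|T\<^sub>1| + 1) + (|T\<^sub>2| + 1)\<close> for all \<open>T\<^sub>1\<close>, \<open>T\<^sub>2\<close>. Unmixedness of the \<open>J\<^sub>H\<^sub>i\<close> means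
  \<open>c(T\<^sub>i) = |T\<^sub>i| + 1\<close>, which clearly implies this; conversely, take \<open>T\<^sub>1\<close> or \<open>T\<^sub>2\<close> empty.
\<close>

section \<open>Contracting monomials\<close>

abbreviation (input) "keys \<equiv> Poly_Mapping.keys"
abbreviation (input) "lookup \<equiv> Poly_Mapping.lookup"
abbreviation (input) "single \<equiv> Poly_Mapping.single"

lemma poly_mapping_eq_sum_single:
  assumes "finite A" "keys p \<subseteq> A"
  shows "p = (\<Sum>m\<in>A. single m (lookup p m))"
proof (rule poly_mapping_eqI)
  fix k
  have "lookup (\<Sum>m\<in>A. single m (lookup p m)) k = (\<Sum>m\<in>A. if m = k then lookup p m else 0)"
    by (simp add: lookup_sum lookup_single when_def)
  also have "\<dots> = lookup p k"
    using assms by (auto simp: in_keys_iff)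
  finally show "lookup p k = lookup (\<Sum>m\<in>A. single m (lookup p m)) k" ..
qed

text \<open>
  The linear map between monoid algebras induced by a partial map of monomials: its coefficient at
  \<open>c\<close> is the sum of the coefficients of \<open>p\<close> over the class of \<open>c\<close>, and monomials mapped to \<open>None\<close>
  are killed.
\<close>

definition contract :: "('m \<Rightarrow> 'c option) \<Rightarrow> ('m \<Rightarrow>\<^sub>0 'k::comm_monoid_add) \<Rightarrow> ('c \<Rightarrow>\<^sub>0 'k)" where
  "contract \<kappa> p = (\<Sum>m\<in>keys p. case \<kappa> m of None \<Rightarrow> 0 | Some c \<Rightarrow> single c (lookup p m))"

lemma contract_superset:
  assumes "finite A" "keys p \<subseteq> A"
  shows "contract \<kappa> p = (\<Sum>m\<in>A. case \<kappa> m of None \<Rightarrow> 0 | Some c \<Rightarrow> single c (lookup p m))"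
  unfolding contract_def using assms
  by (intro sum.mono_neutral_left) (auto simp: in_keys_iff split: option.splits)

lemma contract_0 [simp]: "contract \<kappa> 0 = 0"
  by (simp add: contract_def)

lemma contract_add: "contract \<kappa> (p + q) = contract \<kappa> p + contract \<kappa> q"
proof -
  let ?A = "keys p \<union> keys q"
  have "contract \<kappa> (p + q) = (\<Sum>m\<in>?A. case \<kappa> m of None \<Rightarrow> 0 | Some c \<Rightarrow> single c (lookup (p + q) m))"
    by (intro contract_superset) (auto dest: subsetD[OF Poly_Mapping.keys_add])
  moreover have "contract \<kappa> p = (\<Sum>m\<in>?A. case \<kappa> m of None \<Rightarrow> 0 | Some c \<Rightarrow> single c (lookup p m))"
    by (intro contract_superset) auto
  moreover have "contract \<kappa> q = (\<Sum>m\<in>?A. case \<kappa> m of None \<Rightarrow> 0 | Some c \<Rightarrow> single c (lookup q m))"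
    by (intro contract_superset) auto
  ultimately show ?thesis
    by (auto simp: lookup_add single_add simp flip: sum.distrib intro!: sum.cong split: option.splits)
qed

lemma contract_uminus: "contract \<kappa> (- p) = - contract \<kappa> p" for p :: "'m \<Rightarrow>\<^sub>0 'k::ab_group_add"
  using contract_add[of \<kappa> p "- p"] by (simp add: add_eq_0_iff)

lemma contract_diff: "contract \<kappa> (p - q) = contract \<kappa> p - contract \<kappa> q"
  for p :: "'m \<Rightarrow>\<^sub>0 'k::ab_group_add"
  using contract_add[of \<kappa> p "- q"] by (simp add: contract_uminus)

lemma contract_sum: "contract \<kappa> (\<Sum>i\<in>I. f i) = (\<Sum>i\<in>I. contract \<kappa> (f i))"
  by (induction I rule: infinite_finite_induct) (simp_all add: contract_add)

lemma contract_single: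
  "contract \<kappa> (single m a) = (case \<kappa> m of None \<Rightarrow> 0 | Some c \<Rightarrow> single c a)"
  by (simp add: contract_def split: option.splits)

text \<open>
  Here \<open>\<kappa>\<close> is a homomorphism into the target monoid with an absorbing element \<open>None\<close> adjoined, so
  it induces a ring homomorphism.
\<close>

lemma contract_mult:
  fixes \<kappa> :: "'m::comm_monoid_add \<Rightarrow> 'c::comm_monoid_add option" and p q :: "'m \<Rightarrow>\<^sub>0 'k::comm_semiring_1"
  assumes hom: "\<And>m n. \<kappa> (m + n) = (case \<kappa> m of None \<Rightarrow> None | Some a \<Rightarrow> map_option (\<lambda>b. a + b) (\<kappa> n))"
  shows "contract \<kappa> (p * q) = contract \<kappa> p * contract \<kappa> q"
proof -
  have "p * q = (\<Sum>m\<in>keys p. single m (lookup p m)) * (\<Sum>n\<in>keys q. single n (lookup q n))"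
    by (intro arg_cong2[where f = "(*)"] poly_mapping_eq_sum_single) simp_all
  also have "\<dots> = (\<Sum>m\<in>keys p. \<Sum>n\<in>keys q. single (m + n) (lookup p m * lookup q n))"
    by (simp add: sum_product mult_single)
  also have "contract \<kappa> \<dots> = (\<Sum>m\<in>keys p. \<Sum>n\<in>keys q.
      (case \<kappa> m of None \<Rightarrow> 0 | Some c \<Rightarrow> single c (lookup p m)) *
      (case \<kappa> n of None \<Rightarrow> 0 | Some c \<Rightarrow> single c (lookup q n)))"
    unfolding contract_sum
    by (intro sum.cong refl) (simp add: contract_single hom mult_single split: option.splits)
  also have "\<dots> = contract \<kappa> p * contract \<kappa> q"
    by (simp add: contract_def sum_product)
  finally show ?thesis .
qed

text \<open>
  On the monomials of \<open>p\<close> the map \<open>\<kappa>'\<close> factors through \<open>\<kappa>\<close>, so the second contraction factors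
  through the first. All inclusions between kernels below come from this.
\<close>

lemma contract_eq_0_mono:
  assumes none: "\<And>m. m \<in> keys p \<Longrightarrow> \<kappa> m = None \<Longrightarrow> \<kappa>' m = None"
    and some: "\<And>m n. m \<in> keys p \<Longrightarrow> n \<in> keys p \<Longrightarrow> \<kappa> m = \<kappa> n \<Longrightarrow> \<kappa>' m = \<kappa>' n"
    and "contract \<kappa> p = 0"
  shows "contract \<kappa>' p = 0"
proof -
  define g where "g c = \<kappa>' (SOME m. m \<in> keys p \<and> \<kappa> m = Some c)" for c
  have g: "g c = \<kappa>' m" if "m \<in> keys p" "\<kappa> m = Some c" for m c
  proof -
    have "(SOME m. m \<in> keys p \<and> \<kappa> m = Some c) \<in> keys p \<and> \<kappa> (SOME m. m \<in> keys p \<and> \<kappa> m = Some c) = Some c"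
      by (rule someI[of "\<lambda>m. m \<in> keys p \<and> \<kappa> m = Some c" m]) (use that in simp)
    with that show ?thesis
      unfolding g_def by (intro some) simp_all
  qed
  have "contract g (contract \<kappa> p) = contract \<kappa>' p"
    unfolding contract_def[of \<kappa>] contract_def[of \<kappa>'] contract_sum
    by (intro sum.cong refl) (auto simp: contract_single none g split: option.split)
  with assms(3) show ?thesis by simp
qed

section \<open>The polynomial ring\<close>

lemma poly_ring_simps [simp]:
  "monoid.mult (poly_ring K V) = (*)" "one (poly_ring K V) = 1"
  "zero (poly_ring K V) = 0" "add (poly_ring K V) = (+)"
  by (simp_all add: poly_ring_def)

lemma in_carrier_poly_ring_iff:
  "p \<in> carrier (poly_ring K V) \<longleftrightarrow> (\<forall>m\<in>keys p. keys m \<subseteq> X ` V \<union> Y ` V)"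
  by (simp add: poly_ring_def)

lemma single_in_carrier_poly_ring:
  "keys m \<subseteq> X ` V \<union> Y ` V \<Longrightarrow> single m a \<in> carrier (poly_ring K V)"
  by (simp add: in_carrier_poly_ring_iff)

lemma a_inv_poly_ring:
  assumes "p \<in> carrier (poly_ring K V)"
  shows "\<ominus>\<^bsub>poly_ring K V\<^esub> p = - p"
proof -
  interpret cring "poly_ring K V" by (rule cring_poly_ring)
  have "- p \<in> carrier (poly_ring K V)"
    using assms by (simp add: in_carrier_poly_ring_iff)
  then show ?thesis
    using assms by (intro minus_equality) simp_all
qed

lemma uminus_in_carrier: "p \<in> carrier (poly_ring K V) \<Longrightarrow> - p \<in> carrier (poly_ring K V)"
  by (simp add: in_carrier_poly_ring_iff)

lemma add_in_carrier:
  "p \<in> carrier (poly_ring K V) \<Longrightarrow> q \<in> carrier (poly_ring K V) \<Longrightarrow> p + q \<in> carrier (poly_ring K V)"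
  using ring.ring_simprules(1)[OF cring.axioms(1)[OF cring_poly_ring], of p K V q] by simp

lemma mult_in_carrier:
  "p \<in> carrier (poly_ring K V) \<Longrightarrow> q \<in> carrier (poly_ring K V) \<Longrightarrow> p * q \<in> carrier (poly_ring K V)"
  using ring.ring_simprules(5)[OF cring.axioms(1)[OF cring_poly_ring], of p K V q] by simp

lemma diff_in_carrier:
  "p \<in> carrier (poly_ring K V) \<Longrightarrow> q \<in> carrier (poly_ring K V) \<Longrightarrow> p - q \<in> carrier (poly_ring K V)"
  using add_in_carrier[of p K V "- q"] by (simp add: uminus_in_carrier)

lemma zero_in_carrier: "0 \<in> carrier (poly_ring K V)"
  by (simp add: in_carrier_poly_ring_iff)

lemma one_in_carrier: "1 \<in> carrier (poly_ring K V)"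
  by (simp add: in_carrier_poly_ring_iff)

lemma sum_in_carrier:
  "(\<And>i. i \<in> I \<Longrightarrow> f i \<in> carrier (poly_ring K V)) \<Longrightarrow> sum f I \<in> carrier (poly_ring K V)"
  by (induction I rule: infinite_finite_induct) (auto simp: zero_in_carrier add_in_carrier)

lemma ideal_poly_ring_closed:
  assumes "ideal J (poly_ring K V)"
  shows "J \<subseteq> carrier (poly_ring K V)" "0 \<in> J"
    "\<And>p q. p \<in> J \<Longrightarrow> q \<in> J \<Longrightarrow> p + q \<in> J"
    "\<And>p. p \<in> J \<Longrightarrow> - p \<in> J"
    "\<And>p q. p \<in> J \<Longrightarrow> q \<in> J \<Longrightarrow> p - q \<in> J"
    "\<And>p q. p \<in> J \<Longrightarrow> q \<in> carrier (poly_ring K V) \<Longrightarrow> q * p \<in> J"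
    "\<And>I f. (\<And>i. i \<in> I \<Longrightarrow> f i \<in> J) \<Longrightarrow> sum f I \<in> J"
proof -
  interpret ideal J "poly_ring K V" by fact
  show *: "J \<subseteq> carrier (poly_ring K V)" "0 \<in> J"
    "\<And>p q. p \<in> J \<Longrightarrow> q \<in> J \<Longrightarrow> p + q \<in> J"
    using a_subset additive_subgroup.zero_closed[OF is_additive_subgroup]
      additive_subgroup.a_closed[OF is_additive_subgroup] by auto
  show neg: "- p \<in> J" if "p \<in> J" for p
    using that additive_subgroup.a_inv_closed[OF is_additive_subgroup that] a_inv_poly_ring[of p K V] * by auto
  show "p - q \<in> J" if "p \<in> J" "q \<in> J" for p q
    using *(3)[OF that(1) neg[OF that(2)]] by simp
  show "q * p \<in> J" if "p \<in> J" "q \<in> carrier (poly_ring K V)" for p q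
    using I_l_closed[OF that] by simp
  show "sum f I \<in> J" if "\<And>i. i \<in> I \<Longrightarrow> f i \<in> J" for I f
    using that by (induction I rule: infinite_finite_induct) (auto simp: *)
qed

text \<open>
  Choose a representative in each class. Replacing all monomials of \<open>p\<close> by their representatives
  changes \<open>p\<close> by an element of \<open>J\<close>, and the result has the class sums as coefficients.
\<close>

lemma in_ideal_if_class_sums_0:
  fixes K :: "'k::field itself" and p :: "('v, 'k) mpoly"
  assumes J: "ideal J (poly_ring K V)"
    and p: "p \<in> carrier (poly_ring K V)"
    and moves: "\<And>m n. m \<in> keys p \<Longrightarrow> n \<in> keys p \<Longrightarrow> \<kappa> m = \<kappa> n \<Longrightarrow> single m 1 - single n 1 \<in> J"
    and 0: "contract (\<lambda>m. Some (\<kappa> m)) p = 0"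
  shows "p \<in> J"
proof -
  note J_closed = ideal_poly_ring_closed[OF J]
  \<comment> \<open>The representative is taken among the monomials of \<open>p\<close>, where congruences are available.\<close>
  define \<rho> where "\<rho> c = (SOME m. m \<in> keys p \<and> \<kappa> m = c)" for c
  have \<rho>: "\<rho> (\<kappa> m) \<in> keys p" "\<kappa> (\<rho> (\<kappa> m)) = \<kappa> m" if "m \<in> keys p" for m
    using someI[of "\<lambda>n. n \<in> keys p \<and> \<kappa> n = \<kappa> m" m] that by (simp_all add: \<rho>_def)
  have "contract (\<lambda>m. Some (\<rho> (\<kappa> m))) p = 0"
    by (rule contract_eq_0_mono[OF _ _ 0]) simp_all
  then have "(\<Sum>m\<in>keys p. single (\<rho> (\<kappa> m)) (lookup p m)) = 0"
    by (simp add: contract_def)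
  moreover have "p = (\<Sum>m\<in>keys p. single m (lookup p m))"
    by (rule poly_mapping_eq_sum_single) simp_all
  ultimately have "p = (\<Sum>m\<in>keys p. single m (lookup p m) - single (\<rho> (\<kappa> m)) (lookup p m))"
    by (simp add: sum_subtractf)
  also have "\<dots> = (\<Sum>m\<in>keys p. single 0 (lookup p m) * (single m 1 - single (\<rho> (\<kappa> m)) 1))"
    by (simp add: right_diff_distrib mult_single)
  also have "\<dots> \<in> J"
    using \<rho> by (intro J_closed(7) J_closed(6) moves) (auto intro: single_in_carrier_poly_ring)
  finally show ?thesis .
qed

section \<open>Toric primes\<close>

text \<open>
  Any linear order on the indeterminates will do. It makes the exponent functions a linearly ordered
  cancellative monoid, so that the monoid algebra over a field has no zero divisors.
\<close>

instantiation indet :: (linorder) linorder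
begin

fun less_eq_indet :: "'a indet \<Rightarrow> 'a indet \<Rightarrow> bool" where
  "X i \<le> X j \<longleftrightarrow> i \<le> j"
| "X i \<le> Y j \<longleftrightarrow> True"
| "Y i \<le> X j \<longleftrightarrow> False"
| "Y i \<le> Y j \<longleftrightarrow> i \<le> j"

definition less_indet :: "'a indet \<Rightarrow> 'a indet \<Rightarrow> bool" where
  "less_indet z z' = (z \<le> z' \<and> \<not> z' \<le> z)"

instance
proof
  fix x y z :: "'a indet"
  show "x < y \<longleftrightarrow> x \<le> y \<and> \<not> y \<le> x" by (rule less_indet_def)
  show "x \<le> x" by (cases x) simp_all
  show "x \<le> y \<Longrightarrow> y \<le> z \<Longrightarrow> x \<le> z" by (cases x; cases y; cases z) simp_all
  show "x \<le> y \<Longrightarrow> y \<le> x \<Longrightarrow> x = y" by (cases x; cases y) simp_all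
  show "x \<le> y \<or> y \<le> x" by (cases x; cases y) (simp_all add: linear)
qed

end

text \<open>
  Exponents on \<open>X i\<close> record the slots of the vertex \<open>i\<close>, those on \<open>Y c\<close> the number of tokens on the
  class \<open>{i \<in> V. r i = c}\<close>. This is the monomial map \<open>x\<^sub>i \<mapsto> u\<^sub>i t\<^bsub>r i\<^esub>\<close>, \<open>y\<^sub>i \<mapsto> u\<^sub>i\<close>, with the letters \<open>u\<close> and
  \<open>t\<close> written as \<open>X\<close> and \<open>Y\<close> again.
\<close>

definition weight :: "'v set \<Rightarrow> ('v \<Rightarrow> 'v) \<Rightarrow> ('v indet \<Rightarrow>\<^sub>0 nat) \<Rightarrow> ('v indet \<Rightarrow>\<^sub>0 nat)" where
  "weight V r m = Abs_poly_mapping (\<lambda>z. case z of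
     X i \<Rightarrow> lookup m (X i) + lookup m (Y i)
   | Y c \<Rightarrow> \<Sum>i | i \<in> V \<and> r i = c. lookup m (X i))"

lemma lookup_weight:
  assumes "finite V"
  shows "lookup (weight V r m) (X i) = lookup m (X i) + lookup m (Y i)"
    and "lookup (weight V r m) (Y c) = (\<Sum>i | i \<in> V \<and> r i = c. lookup m (X i))"
proof -
  let ?f = "\<lambda>z. case z of X i \<Rightarrow> lookup m (X i) + lookup m (Y i)
   | Y c \<Rightarrow> \<Sum>i | i \<in> V \<and> r i = c. lookup m (X i)"
  have "{z. ?f z \<noteq> 0} \<subseteq> keys m \<union> (\<lambda>z. case z of X i \<Rightarrow> Y i | Y i \<Rightarrow> X i) ` keys m \<union> Y ` r ` V"
  proof
    fix z assume z: "z \<in> {z. ?f z \<noteq> 0}"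
    show "z \<in> keys m \<union> (\<lambda>z. case z of X i \<Rightarrow> Y i | Y i \<Rightarrow> X i) ` keys m \<union> Y ` r ` V"
    proof (cases z)
      case (X i)
      with z have "X i \<in> keys m \<or> Y i \<in> keys m" by (auto simp: in_keys_iff)
      with X show ?thesis by force
    next
      case (Y c)
      with z have "{i. i \<in> V \<and> r i = c} \<noteq> {}" by fastforce
      with Y show ?thesis by auto
    qed
  qed
  then have "finite {z. ?f z \<noteq> 0}"
    by (rule finite_subset) (use assms in simp)
  then have "lookup (weight V r m) = ?f"
    unfolding weight_def by (rule lookup_Abs_poly_mapping)
  then show "lookup (weight V r m) (X i) = lookup m (X i) + lookup m (Y i)"
    and "lookup (weight V r m) (Y c) = (\<Sum>i | i \<in> V \<and> r i = c. lookup m (X i))"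
    by simp_all
qed

lemma weight_eq_iff:
  assumes "finite V"
  shows "weight V r m = weight V r n \<longleftrightarrow>
    (\<forall>i. lookup m (X i) + lookup m (Y i) = lookup n (X i) + lookup n (Y i)) \<and>
    (\<forall>c. (\<Sum>i | i \<in> V \<and> r i = c. lookup m (X i)) = (\<Sum>i | i \<in> V \<and> r i = c. lookup n (X i)))"
  (is "?L \<longleftrightarrow> ?R")
proof
  assume L: ?L
  show ?R
    using arg_cong[OF L, of "\<lambda>w. lookup w (X _)"] arg_cong[OF L, of "\<lambda>w. lookup w (Y _)"]
    by (simp add: lookup_weight[OF assms])
next
  assume ?R
  then show ?L
    by (intro poly_mapping_eqI) (case_tac k; simp add: lookup_weight[OF assms])
qed

lemma weight_add:
  assumes "finite V"
  shows "weight V r (m + n) = weight V r m + weight V r n"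
  by (intro poly_mapping_eqI) (case_tac k; simp add: lookup_weight[OF assms] lookup_add sum.distrib)

lemma weight_0 [simp]:
  assumes "finite V"
  shows "weight V r 0 = 0"
  by (intro poly_mapping_eqI) (case_tac k; simp add: lookup_weight[OF assms])

lemma keys_add_nat: "keys (m + n) = keys m \<union> keys n" for m n :: "'a \<Rightarrow>\<^sub>0 nat"
  by (auto simp: in_keys_iff lookup_add)

text \<open>
  The set \<open>Z\<close> consists of the variables that are sent to zero.
\<close>

definition invariant ::
  "'v set \<Rightarrow> 'v indet set \<Rightarrow> ('v \<Rightarrow> 'v) \<Rightarrow> ('v indet \<Rightarrow>\<^sub>0 nat) \<Rightarrow> ('v indet \<Rightarrow>\<^sub>0 nat) option" where
  "invariant V Z r m = (if keys m \<inter> Z = {} then Some (weight V r m) else None)"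

definition toric_prime ::
  "'k::field itself \<Rightarrow> 'v set \<Rightarrow> 'v indet set \<Rightarrow> ('v \<Rightarrow> 'v) \<Rightarrow> ('v, 'k) mpoly set" where
  "toric_prime K V Z r = {p \<in> carrier (poly_ring K V). contract (invariant V Z r) p = 0}"

lemma primeideal_toric_prime:
  fixes K :: "'k::field itself" and V :: "'v::linorder set"
  assumes V: "finite V"
  shows "primeideal (toric_prime K V Z r) (poly_ring K V)"
proof -
  interpret R: cring "poly_ring K V" by (rule cring_poly_ring)
  have mult: "contract (invariant V Z r) (p * q)
      = contract (invariant V Z r) p * contract (invariant V Z r) q" for p q :: "('v, 'k) mpoly"
    by (rule contract_mult) (auto simp: invariant_def weight_add[OF V] keys_add_nat)
  have "contract (invariant V Z r) (1 :: ('v, 'k) mpoly) = single 0 1"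
    unfolding single_one[symmetric] contract_single by (simp add: invariant_def V)
  then have one: "contract (invariant V Z r) (1 :: ('v, 'k) mpoly) \<noteq> 0"
    by (metis lookup_single_eq lookup_zero one_neq_zero)
  have subgroup: "additive_subgroup (toric_prime K V Z r) (poly_ring K V)"
  proof (intro additive_subgroupI R.add.subgroupI)
    fix p assume p: "p \<in> toric_prime K V Z r"
    then have "\<ominus>\<^bsub>poly_ring K V\<^esub> p = - p"
      by (intro a_inv_poly_ring) (simp add: toric_prime_def)
    with p show "\<ominus>\<^bsub>poly_ring K V\<^esub> p \<in> toric_prime K V Z r"
      by (simp add: toric_prime_def contract_uminus uminus_in_carrier)
  next
    show "toric_prime K V Z r \<noteq> {}"
      using zero_in_carrier[of K V] by (auto simp: toric_prime_def intro!: exI[of _ 0])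
  qed (auto simp: toric_prime_def contract_add add_in_carrier)
  show ?thesis
  proof (rule primeidealI2[OF subgroup cring_poly_ring])
    show "carrier (poly_ring K V) \<noteq> toric_prime K V Z r"
      using one one_in_carrier[of K V] by (auto simp: toric_prime_def)
  qed (auto simp: toric_prime_def mult mult_in_carrier)
qed

lemma toric_prime_mono:
  assumes "\<And>m. keys m \<subseteq> X ` V \<union> Y ` V \<Longrightarrow> invariant V Z r m = None \<Longrightarrow> invariant V Z' r' m = None"
    and "\<And>m n. keys m \<subseteq> X ` V \<union> Y ` V \<Longrightarrow> keys n \<subseteq> X ` V \<union> Y ` V \<Longrightarrow>
      invariant V Z r m = invariant V Z r n \<Longrightarrow> invariant V Z' r' m = invariant V Z' r' n"
  shows "toric_prime K V Z r \<subseteq> toric_prime K V Z' r'"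
proof
  fix p assume p: "p \<in> toric_prime K V Z r"
  then have keys: "keys m \<subseteq> X ` V \<union> Y ` V" if "m \<in> keys p" for m
    using that by (simp add: toric_prime_def in_carrier_poly_ring_iff)
  have "contract (invariant V Z' r') p = 0"
  proof (rule contract_eq_0_mono)
    show "contract (invariant V Z r) p = 0"
      using p by (simp add: toric_prime_def)
  qed (fact assms(1)[OF keys] assms(2)[OF keys keys])+
  with p show "p \<in> toric_prime K V Z' r'"
    by (simp add: toric_prime_def)
qed

lemma var_in_toric_prime_iff:
  fixes K :: "'k::field itself"
  assumes "z \<in> X ` V \<union> Y ` V"
  shows "var K z \<in> toric_prime K V Z r \<longleftrightarrow> z \<in> Z"
proof -
  have "single (weight V r (single z 1)) (1::'k) \<noteq> 0"
    by (metis lookup_single_eq lookup_zero one_neq_zero)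
  then show ?thesis
    using assms by (auto simp: toric_prime_def var_def contract_single invariant_def
        intro!: single_in_carrier_poly_ring)
qed

section \<open>Chains of primes\<close>

text \<open>
  Gaussian elimination: one equation is used to eliminate one unknown.
\<close>

lemma linear_system_nontrivial_solution:
  fixes a :: "'i \<Rightarrow> 'j \<Rightarrow> 'k::field"
  assumes "finite J" "finite I" "card J < card I"
  shows "\<exists>k. (\<exists>i\<in>I. k i \<noteq> 0) \<and> (\<forall>j\<in>J. (\<Sum>i\<in>I. k i * a i j) = 0)"
  using assms
proof (induction J arbitrary: I a rule: finite_induct)
  case empty
  then have "I \<noteq> {}" by auto
  then show ?case by (intro exI[of _ "\<lambda>_. 1"]) auto
next
  case (insert j0 J)
  show ?case
  proof (cases "\<forall>i\<in>I. a i j0 = 0")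
    case True
    from insert.hyps insert.prems have "card J < card I" by simp
    from insert.IH[OF insert.prems(1) this, of a] True show ?thesis by auto
  next
    case False
    then obtain i0 where i0: "i0 \<in> I" "a i0 j0 \<noteq> 0" by blast
    define b where "b i j = a i j - a i j0 / a i0 j0 * a i0 j" for i j
    have "card J < card (I - {i0})"
      using insert.hyps insert.prems i0 by simp
    from insert.IH[OF _ this, of b] insert.prems(1) obtain k where
      k: "\<exists>i\<in>I - {i0}. k i \<noteq> 0" "\<And>j. j \<in> J \<Longrightarrow> (\<Sum>i\<in>I - {i0}. k i * b i j) = 0" by auto
    define s where "s = (\<Sum>i\<in>I - {i0}. k i * (a i j0 / a i0 j0))"
    define k' where "k' = k(i0 := - s)"
    have sum: "(\<Sum>i\<in>I. k' i * a i j) = - s * a i0 j + (\<Sum>i\<in>I - {i0}. k i * a i j)" for j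
      using insert.prems(1) i0(1) by (simp add: sum.remove[of I i0] k'_def)
    have "(\<Sum>i\<in>I - {i0}. k i * a i j) = (\<Sum>i\<in>I - {i0}. k i * b i j) + s * a i0 j" for j
      unfolding s_def sum_distrib_right sum.distrib[symmetric]
      by (intro sum.cong refl) (simp add: b_def algebra_simps)
    moreover have "(\<Sum>i\<in>I - {i0}. k i * b i j0) = 0"
      using i0 by (simp add: b_def)
    ultimately have "\<forall>j\<in>insert j0 J. (\<Sum>i\<in>I. k' i * a i j) = 0"
      using k(2) by (simp add: sum)
    moreover have "\<exists>i\<in>I. k' i \<noteq> 0"
      using k(1) by (auto simp: k'_def)
    ultimately show ?thesis by blast
  qed
qed

definition exponents :: "nat \<Rightarrow> nat \<Rightarrow> nat list set" where
  "exponents D n = {\<alpha>. set \<alpha> \<subseteq> {..<D} \<and> length \<alpha> = n}"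

definition power_product :: "'a::comm_semiring_1 list \<Rightarrow> nat list \<Rightarrow> 'a" where
  "power_product fs \<alpha> = prod_list (map2 (^) fs \<alpha>)"

lemma power_product_simps [simp]:
  "power_product [] \<alpha> = 1"
  "power_product (f # fs) (j # \<alpha>) = f ^ j * power_product fs \<alpha>"
  by (simp_all add: power_product_def)

lemma exponents_0 [simp]: "exponents D 0 = {[]}"
  by (auto simp: exponents_def)

lemma finite_exponents: "finite (exponents D n)"
  by (simp add: exponents_def finite_lists_length_eq)

lemma card_exponents: "card (exponents D n) = D ^ n"
  by (simp add: exponents_def card_lists_length_eq)

lemma Cons_in_exponents [simp]: "j # \<alpha> \<in> exponents D (Suc n) \<longleftrightarrow> j < D \<and> \<alpha> \<in> exponents D n"
  by (auto simp: exponents_def)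

lemma sum_exponents_Suc:
  "(\<Sum>\<alpha>\<in>exponents D (Suc n). g \<alpha>) = (\<Sum>j<D. \<Sum>\<alpha>\<in>exponents D n. g (j # \<alpha>))"
proof -
  have "(\<Sum>j<D. \<Sum>\<alpha>\<in>exponents D n. g (j # \<alpha>)) = (\<Sum>(j, \<alpha>)\<in>{..<D} \<times> exponents D n. g (j # \<alpha>))"
    by (simp add: sum.cartesian_product)
  also have "\<dots> = (\<Sum>\<alpha>\<in>exponents D (Suc n). g \<alpha>)"
    by (rule sum.reindex_bij_witness[of _ "\<lambda>\<alpha>. (hd \<alpha>, tl \<alpha>)" "\<lambda>(j, \<alpha>). j # \<alpha>"])
      (auto simp: exponents_def length_Suc_conv)
  finally show ?thesis ..
qed

lemma power_in_carrier: "p \<in> carrier (poly_ring K V) \<Longrightarrow> p ^ n \<in> carrier (poly_ring K V)"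
  by (induction n) (simp_all add: one_in_carrier mult_in_carrier)

lemma power_product_in_carrier:
  "set fs \<subseteq> carrier (poly_ring K V) \<Longrightarrow> \<alpha> \<in> exponents D (length fs) \<Longrightarrow>
    power_product fs \<alpha> \<in> carrier (poly_ring K V)"
proof (induction fs arbitrary: \<alpha>)
  case (Cons f fs)
  then show ?case
    by (cases \<alpha>) (auto simp: mult_in_carrier power_in_carrier exponents_def)
qed (simp add: one_in_carrier)

lemma primeideal_mult_iff:
  assumes "primeideal P (poly_ring K V)" "p \<in> carrier (poly_ring K V)" "q \<in> carrier (poly_ring K V)"
  shows "p * q \<in> P \<longleftrightarrow> p \<in> P \<or> q \<in> P"
proof -
  interpret primeideal P "poly_ring K V" by fact
  show ?thesis
    using assms I_prime[of p q] I_l_closed[of q p] I_r_closed[of p q] by auto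
qed

lemma primeideal_one_notin: "primeideal P (poly_ring K V) \<Longrightarrow> 1 \<notin> P"
  using ideal.one_imp_carrier[of P "poly_ring K V"] primeideal.I_notcarr[of P "poly_ring K V"]
  by (auto dest: primeideal.axioms(1))

lemma primeideal_power_imp:
  assumes "primeideal P (poly_ring K V)" "p \<in> carrier (poly_ring K V)" "p ^ n \<in> P"
  shows "p \<in> P"
  using assms(3)
  by (induction n) (auto simp: primeideal_one_notin[OF assms(1)]
      primeideal_mult_iff[OF assms(1,2) power_in_carrier[OF assms(2)]])

text \<open>
  A relation between the elements \<open>fs\<close>, with coefficients in \<open>A\<close>, is read as a polynomial in the first
  of them, \<open>f\<close>. Divide it by the lowest power of \<open>f\<close> that occurs, which is possible modulo the prime
  \<open>Q 0\<close> because \<open>f \<notin> Q 0\<close>, and then reduce modulo \<open>Q 1\<close>, where \<open>f\<close> vanishes. Only the lowest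
  coefficient is left, and it is a relation between the remaining elements along the remaining chain.
  At the end of the chain it is an element of \<open>A\<close> in the last prime, hence zero.
\<close>

lemma power_products_independent_along_chain:
  fixes c :: "nat list \<Rightarrow> ('v, 'k::field) mpoly"
  assumes "\<And>i. i \<le> length fs \<Longrightarrow> primeideal (Q i) (poly_ring K V)"
    and "\<And>i. i < length fs \<Longrightarrow> Q i \<subseteq> Q (Suc i) \<and> fs ! i \<in> Q (Suc i) - Q i"
    and "A \<subseteq> carrier (poly_ring K V)" "0 \<in> A" "A \<inter> Q (length fs) \<subseteq> {0}"
    and "\<And>\<alpha>. \<alpha> \<in> exponents D (length fs) \<Longrightarrow> c \<alpha> \<in> A"
    and "(\<Sum>\<alpha>\<in>exponents D (length fs). c \<alpha> * power_product fs \<alpha>) \<in> Q 0"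
    and "\<alpha> \<in> exponents D (length fs)"
  shows "c \<alpha> = 0"
  using assms
proof (induction fs arbitrary: Q c \<alpha>)
  case Nil
  then show ?case by auto
next
  case (Cons f fs)
  note prime = Cons.prems(1) and step = Cons.prems(2) and A = Cons.prems(3,4,5)
    and c = Cons.prems(6) and rel = Cons.prems(7)
  let ?R = "poly_ring K V" and ?n = "length fs"
  have carrier_Q: "Q i \<subseteq> carrier ?R" if "i \<le> Suc ?n" for i
    using ideal_poly_ring_closed(1)[OF primeideal.axioms(1)[OF prime]] that by simp
  have f: "f \<in> carrier ?R" "f \<in> Q 1" "f \<notin> Q 0" "Q 0 \<subseteq> Q 1"
    using step[of 0] carrier_Q[of 1] by auto
  have fs: "set fs \<subseteq> carrier ?R"
  proof
    fix g assume "g \<in> set fs"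
    then obtain i where "i < ?n" "g = fs ! i" by (metis in_set_conv_nth)
    then show "g \<in> carrier ?R"
      using step[of "Suc i"] carrier_Q[of "Suc (Suc i)"] by auto
  qed
  define e where "e j = (\<Sum>\<alpha>\<in>exponents D ?n. c (j # \<alpha>) * power_product fs \<alpha>)" for j
  have e: "e j \<in> carrier ?R" if "j < D" for j
    unfolding e_def using that fs A(1) c
    by (intro sum_in_carrier mult_in_carrier power_product_in_carrier) auto
  have rel': "(\<Sum>j<D. f ^ j * e j) \<in> Q 0"
  proof -
    have "(\<Sum>j<D. f ^ j * e j) = (\<Sum>\<alpha>\<in>exponents D (Suc ?n). c \<alpha> * power_product (f # fs) \<alpha>)"
      by (simp add: sum_exponents_Suc e_def sum_distrib_left mult_ac)
    with rel show ?thesis by simp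
  qed
  have "\<forall>\<alpha>\<in>exponents D ?n. c (j # \<alpha>) = 0" if "j < D" for j
    using that
  proof (induction j rule: less_induct)
    case (less j)
    \<comment> \<open>Coefficients below \<open>j\<close> vanish, so the relation is \<open>f ^ j * (e j + f * g)\<close>.\<close>
    define g where "g = (\<Sum>i\<in>{Suc j..<D}. f ^ (i - Suc j) * e i)"
    have g: "g \<in> carrier ?R"
      unfolding g_def by (intro sum_in_carrier mult_in_carrier power_in_carrier f e) auto
    have "e i = 0" if "i < j" for i
      using less.IH[OF that] less.prems that by (simp add: e_def)
    then have "(\<Sum>i<D. f ^ i * e i) = (\<Sum>i\<in>{j..<D}. f ^ i * e i)"
      by (intro sum.mono_neutral_right) auto
    also have "\<dots> = f ^ j * e j + (\<Sum>i\<in>{Suc j..<D}. f ^ i * e i)"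
      using less.prems by (rule sum.atLeast_Suc_lessThan)
    also have "(\<Sum>i\<in>{Suc j..<D}. f ^ i * e i) = f ^ j * (f * g)"
      unfolding g_def sum_distrib_left
    proof (intro sum.cong refl)
      fix i assume "i \<in> {Suc j..<D}"
      then have "f ^ i = f ^ (j + Suc (i - Suc j))"
        by simp
      then have "f ^ i = f ^ j * (f * f ^ (i - Suc j))"
        by (simp only: power_add power_Suc)
      then show "f ^ i * e i = f ^ j * (f * (f ^ (i - Suc j) * e i))"
        by (simp add: mult_ac)
    qed
    also have "f ^ j * e j + f ^ j * (f * g) = f ^ j * (e j + f * g)"
      by (simp add: distrib_left)
    finally have "f ^ j * (e j + f * g) \<in> Q 0"
      using rel' by simp
    moreover have "f ^ j \<notin> Q 0"
      using primeideal_power_imp[OF prime f(1), of 0 j] f(3) by auto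
    moreover have "e j + f * g \<in> carrier ?R"
      by (intro add_in_carrier mult_in_carrier e less.prems f g)
    ultimately have *: "e j + f * g \<in> Q 1"
      using primeideal_mult_iff[OF prime power_in_carrier[OF f(1)]] f(4) by auto
    note Q1 = ideal_poly_ring_closed[OF primeideal.axioms(1)[OF prime[of 1]]]
    have "g * f \<in> Q 1"
      by (rule Q1(6)) (use f g in auto)
    then have "(e j + f * g) - f * g \<in> Q 1"
      by (intro Q1(5) *) (simp_all add: mult.commute)
    then have ej: "(\<Sum>\<alpha>\<in>exponents D ?n. c (j # \<alpha>) * power_product fs \<alpha>) \<in> Q (Suc 0)"
      by (simp add: e_def)
    show ?case
    proof
      fix \<alpha> assume "\<alpha> \<in> exponents D ?n"
      show "c (j # \<alpha>) = 0"
      proof (rule Cons.IH[where Q = "\<lambda>i. Q (Suc i)" and c = "\<lambda>\<alpha>. c (j # \<alpha>)"])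
        show "primeideal (Q (Suc i)) ?R" if "i \<le> ?n" for i
          using prime[of "Suc i"] that by simp
        show "Q (Suc i) \<subseteq> Q (Suc (Suc i)) \<and> fs ! i \<in> Q (Suc (Suc i)) - Q (Suc i)" if "i < ?n" for i
          using step[of "Suc i"] that by simp
        show "A \<inter> Q (Suc ?n) \<subseteq> {0}" using A by simp
        show "c (j # \<alpha>) \<in> A" if "\<alpha> \<in> exponents D ?n" for \<alpha>
          using c less.prems that by simp
      qed fact+
    qed
  qed
  with Cons.prems(8) show ?case
    by (cases \<alpha>) (auto simp: exponents_def)
qed

definition monomials_below :: "'z set \<Rightarrow> nat \<Rightarrow> ('z \<Rightarrow>\<^sub>0 nat) set" where
  "monomials_below U D = {m. keys m \<subseteq> U \<and> (\<forall>z. lookup m z < D)}"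

lemma monomials_below:
  assumes "finite U" "D > 0"
  shows "finite (monomials_below U D) \<and> card (monomials_below U D) = D ^ card U"
proof -
  have "bij_betw (\<lambda>m. restrict (lookup m) U) (monomials_below U D) (U \<rightarrow>\<^sub>E {..<D})"
  proof (rule bij_betwI[where g = "\<lambda>f. Abs_poly_mapping (\<lambda>z. if z \<in> U then f z else 0)"])
    have lookup: "lookup (Abs_poly_mapping (\<lambda>z. if z \<in> U then f z else 0)) = (\<lambda>z. if z \<in> U then f z else 0)"
      for f :: "'a \<Rightarrow> nat"
      using assms(1) by (intro lookup_Abs_poly_mapping) (auto intro: finite_subset[of _ U])
    show "(\<lambda>m. restrict (lookup m) U) \<in> monomials_below U D \<rightarrow> (U \<rightarrow>\<^sub>E {..<D})"
      by (auto simp: monomials_below_def)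
    show "(\<lambda>f. Abs_poly_mapping (\<lambda>z. if z \<in> U then f z else 0)) \<in> (U \<rightarrow>\<^sub>E {..<D}) \<rightarrow> monomials_below U D"
      using assms(2) by (auto simp: monomials_below_def in_keys_iff lookup PiE_def Pi_def split: if_splits)
    show "Abs_poly_mapping (\<lambda>z. if z \<in> U then restrict (lookup m) U z else 0) = m"
      if "m \<in> monomials_below U D" for m
      using that by (intro poly_mapping_eqI, subst lookup) (auto simp: monomials_below_def in_keys_iff)
    show "restrict (lookup (Abs_poly_mapping (\<lambda>z. if z \<in> U then f z else 0))) U = f"
      if "f \<in> U \<rightarrow>\<^sub>E {..<D}" for f
      using that by (auto simp: lookup fun_eq_iff PiE_def extensional_def)
  qed
  moreover have "finite (U \<rightarrow>\<^sub>E {..<D})" "card (U \<rightarrow>\<^sub>E {..<D}) = D ^ card U"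
    using assms(1) by (simp_all add: finite_PiE card_PiE)
  ultimately show ?thesis
    by (metis bij_betw_finite bij_betw_same_card)
qed

definition exponents_bounded :: "nat \<Rightarrow> (('z \<Rightarrow>\<^sub>0 nat) \<Rightarrow>\<^sub>0 'k::zero) \<Rightarrow> bool" where
  "exponents_bounded e p \<longleftrightarrow> (\<forall>m\<in>keys p. \<forall>z. lookup m z \<le> e)"

lemma exponents_bounded_mono: "exponents_bounded e p \<Longrightarrow> e \<le> e' \<Longrightarrow> exponents_bounded e' p"
  by (auto simp: exponents_bounded_def intro: order_trans)

lemma exponents_bounded_mult:
  fixes p q :: "('z \<Rightarrow>\<^sub>0 nat) \<Rightarrow>\<^sub>0 'k::field"
  assumes "exponents_bounded e p" "exponents_bounded e' q"
  shows "exponents_bounded (e + e') (p * q)"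
  unfolding exponents_bounded_def
proof (intro ballI allI)
  fix m z assume "m \<in> keys (p * q)"
  then obtain a b where "m = a + b" "a \<in> keys p" "b \<in> keys q"
    using Poly_Mapping.keys_mult[of p q] by blast
  with assms show "lookup m z \<le> e + e'"
    by (auto simp: exponents_bounded_def lookup_add intro!: add_mono)
qed

lemma exponents_bounded_power:
  fixes p :: "('z \<Rightarrow>\<^sub>0 nat) \<Rightarrow>\<^sub>0 'k::field"
  assumes "exponents_bounded e p"
  shows "exponents_bounded (n * e) (p ^ n)"
proof (induction n)
  case 0
  then show ?case by (simp add: exponents_bounded_def)
next
  case (Suc n)
  then show ?case using exponents_bounded_mult[OF assms Suc] by simp
qed

lemma exponents_bounded_power_product:
  fixes fs :: "(('z \<Rightarrow>\<^sub>0 nat) \<Rightarrow>\<^sub>0 'k::field) list"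
  assumes "\<And>f. f \<in> set fs \<Longrightarrow> exponents_bounded e f" "\<alpha> \<in> exponents D (length fs)"
  shows "exponents_bounded (length fs * (D * e)) (power_product fs \<alpha>)"
  using assms
proof (induction fs arbitrary: \<alpha>)
  case Nil
  then show ?case by (simp add: exponents_bounded_def)
next
  case (Cons f fs)
  then obtain j \<beta> where \<alpha>: "\<alpha> = j # \<beta>" "j < D" "\<beta> \<in> exponents D (length fs)"
    by (cases \<alpha>) (auto simp: exponents_def)
  have "exponents_bounded (D * e) (f ^ j)"
    using \<alpha>(2) Cons.prems(1)[of f]
    by (intro exponents_bounded_mono[OF exponents_bounded_power[of e] mult_le_mono1]) simp_all
  from exponents_bounded_mult[OF this Cons.IH[OF Cons.prems(1) \<alpha>(3)]] show ?case
    by (simp add: \<alpha>(1))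
qed

lemma ex_exponents_bounded: "\<exists>e. exponents_bounded e p"
proof -
  have "finite (\<Union>m\<in>keys p. lookup m ` keys m)" by simp
  then obtain e where e: "\<And>x. x \<in> (\<Union>m\<in>keys p. lookup m ` keys m) \<Longrightarrow> x \<le> e"
    by (metis finite_nat_set_iff_bounded_le)
  have "exponents_bounded e p"
    unfolding exponents_bounded_def
  proof (intro ballI allI)
    fix m z assume "m \<in> keys p"
    then show "lookup m z \<le> e"
      by (cases "z \<in> keys m") (auto intro!: e simp: in_keys_iff)
  qed
  then show ?thesis ..
qed

lemma lookup_scale: "lookup (single 0 k * p) m = k * lookup p m"
  for p :: "'m::monoid_add \<Rightarrow>\<^sub>0 'k::semiring_1"
  unfolding mult_map_scale_conv_mult[symmetric] by (simp add: Poly_Mapping.map.rep_eq when_def)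

text \<open>
  Pick \<open>f i \<in> Q (i + 1) - Q i\<close>. If \<open>n + card U\<close> exceeds the number \<open>N\<close> of variables, the products of
  the \<open>f i\<close> and the variables in \<open>U\<close> with all exponents below \<open>D\<close> number \<open>D ^ (n + card U)\<close>, whereas
  only \<open>O(D ^ N)\<close> monomials occur in them. For large \<open>D\<close> they are linearly dependent, which contradicts
  the independence along the chain.
\<close>

lemma prime_chain_length_le:
  fixes K :: "'k::field itself" and V :: "'v set"
  assumes V: "finite V" and U: "U \<subseteq> X ` V \<union> Y ` V"
    and prime: "\<And>i. i \<le> n \<Longrightarrow> primeideal (Q i) (poly_ring K V)"
    and strict: "\<And>i. i < n \<Longrightarrow> Q i \<subset> Q (Suc i)"
    and free: "\<And>p. p \<in> Q n \<Longrightarrow> (\<And>m. m \<in> keys p \<Longrightarrow> keys m \<subseteq> U) \<Longrightarrow> p = 0"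
  shows "n + card U \<le> 2 * card V"
proof (rule ccontr)
  assume contra: "\<not> n + card U \<le> 2 * card V"
  let ?W = "X ` V \<union> Y ` V" and ?R = "poly_ring K V"
  have W: "finite ?W" "card ?W = 2 * card V"
  proof -
    have "card ?W = card (X ` V) + card (Y ` V)"
      using V by (intro card_Un_disjoint) auto
    then show "finite ?W" "card ?W = 2 * card V"
      using V by (simp_all add: card_image inj_on_def)
  qed
  have U_fin: "finite U" using U W(1) by (rule finite_subset)
  have "\<forall>i<n. \<exists>f. f \<in> Q (Suc i) - Q i" using strict by blast
  then obtain f where f: "\<And>i. i < n \<Longrightarrow> f i \<in> Q (Suc i) - Q i" by metis
  define fs where "fs = map f [0..<n]"
  have len: "length fs = n" and nth: "\<And>i. i < n \<Longrightarrow> fs ! i = f i"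
    by (simp_all add: fs_def)
  have fs: "set fs \<subseteq> carrier ?R"
  proof -
    have "f i \<in> carrier ?R" if "i < n" for i
      using f[OF that] ideal_poly_ring_closed(1)[OF primeideal.axioms(1)[OF prime[of "Suc i"]]] that by auto
    then show ?thesis by (auto simp: fs_def)
  qed
  obtain \<epsilon> where \<epsilon>: "\<forall>f\<in>set fs. exponents_bounded (\<epsilon> f) f"
    using bchoice[of "set fs" "\<lambda>f e. exponents_bounded e f"] ex_exponents_bounded by blast
  define e where "e = sum \<epsilon> (set fs)"
  have e: "exponents_bounded e f" if "f \<in> set fs" for f
  proof (rule exponents_bounded_mono[OF bspec[OF \<epsilon> that]])
    show "\<epsilon> f \<le> e"
      unfolding e_def using that by (intro member_le_sum) auto
  qed
  \<comment> \<open>Exponents in the products are at most \<open>n * D * e + (D - 1) < D * C\<close>, so \<open>(D * C) ^ N\<close> monomials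
    have to be compared with \<open>D ^ (n + card U)\<close> products; this is why \<open>D\<close> is chosen above \<open>C ^ N\<close>.\<close>
  define C where "C = n * e + 1"
  define D where "D = C ^ (2 * card V) + 1"
  have D: "D > 0" by (simp add: D_def)
  define I where "I = exponents D n \<times> monomials_below U D"
  define J where "J = monomials_below ?W (D * C)"
  have "finite I" "card I = D ^ (n + card U)"
    using monomials_below[OF U_fin D]
    by (simp_all add: I_def finite_exponents card_cartesian_product card_exponents power_add)
  moreover have "finite J" "card J = (D * C) ^ (2 * card V)"
    using monomials_below[OF W(1), of "D * C"] D by (simp_all add: J_def W(2) C_def)
  moreover have "(D * C) ^ (2 * card V) < D ^ (n + card U)"
  proof -
    have "C ^ (2 * card V) < D" by (simp add: D_def)
    then have "(D * C) ^ (2 * card V) < D ^ (2 * card V) * D"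
      unfolding power_mult_distrib using D by (intro mult_strict_left_mono) simp_all
    also have "\<dots> = D ^ Suc (2 * card V)" by simp
    also have "\<dots> \<le> D ^ (n + card U)"
      using contra D by (intro power_increasing) auto
    finally show ?thesis .
  qed
  ultimately have "finite J" "finite I" "card J < card I"
    by simp_all
  define a where "a i m = lookup (power_product fs (fst i) * single (snd i) (1::'k)) m" for i m
  from linear_system_nontrivial_solution[OF \<open>finite J\<close> \<open>finite I\<close> \<open>card J < card I\<close>, of a]
  obtain k where k: "\<exists>i\<in>I. k i \<noteq> 0" and k0: "\<forall>m\<in>J. (\<Sum>i\<in>I. k i * a i m) = 0"
    by blast
  define c where "c \<alpha> = (\<Sum>\<beta>\<in>monomials_below U D. single \<beta> (k (\<alpha>, \<beta>)))" for \<alpha>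
  define A where "A = {p :: ('v, 'k) mpoly. \<forall>m\<in>keys p. keys m \<subseteq> U}"
  have relation: "(\<Sum>\<alpha>\<in>exponents D n. c \<alpha> * power_product fs \<alpha>) = 0"
  proof -
    have "(\<Sum>\<alpha>\<in>exponents D n. c \<alpha> * power_product fs \<alpha>) =
        (\<Sum>\<alpha>\<in>exponents D n. \<Sum>\<beta>\<in>monomials_below U D.
          single 0 (k (\<alpha>, \<beta>)) * (power_product fs \<alpha> * single \<beta> 1))"
      unfolding c_def sum_distrib_right
    proof (intro sum.cong refl)
      fix \<alpha> \<beta>
      have "single \<beta> (k (\<alpha>, \<beta>)) = single 0 (k (\<alpha>, \<beta>)) * single \<beta> 1"
        by (simp add: mult_single)
      then show "single \<beta> (k (\<alpha>, \<beta>)) * power_product fs \<alpha> =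
          single 0 (k (\<alpha>, \<beta>)) * (power_product fs \<alpha> * single \<beta> 1)"
        by (simp only: mult_ac)
    qed
    also have "\<dots> = (\<Sum>i\<in>I. single 0 (k i) * (power_product fs (fst i) * single (snd i) 1))"
      by (simp add: I_def sum.cartesian_product case_prod_unfold)
    also have "\<dots> = 0" (is "?p = 0")
    proof (rule poly_mapping_eqI)
      fix m
      have p: "lookup ?p m = (\<Sum>i\<in>I. k i * a i m)"
        by (simp add: lookup_sum lookup_scale a_def)
      have "(\<Sum>i\<in>I. k i * a i m) = 0"
      proof (cases "m \<in> J")
        case True
        with k0 show ?thesis by blast
      next
        case False
        have "a i m = 0" if "i \<in> I" for i
        proof (rule ccontr)
          let ?q = "power_product fs (fst i) * single (snd i) (1::'k)"
          assume "a i m \<noteq> 0"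
          then have m: "m \<in> keys ?q"
            by (simp add: in_keys_iff a_def)
          from that have \<alpha>: "fst i \<in> exponents D (length fs)" and \<beta>: "snd i \<in> monomials_below U D"
            by (auto simp: I_def len)
          have "keys (snd i) \<subseteq> ?W"
            using \<beta> U by (auto simp: monomials_below_def)
          then have "?q \<in> carrier ?R"
            by (intro mult_in_carrier power_product_in_carrier[OF fs \<alpha>] single_in_carrier_poly_ring)
          with m have keys_m: "keys m \<subseteq> ?W"
            unfolding in_carrier_poly_ring_iff by blast
          have "lookup (snd i) z \<le> D - 1" for z
            using \<beta> D by (simp add: monomials_below_def less_Suc_eq_le[symmetric])
          then have "exponents_bounded (D - 1) (single (snd i) (1::'k))"
            by (simp add: exponents_bounded_def)
          with exponents_bounded_power_product[OF e \<alpha>]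
          have "exponents_bounded (length fs * (D * e) + (D - 1)) ?q"
            by (rule exponents_bounded_mult)
          with m have "lookup m z \<le> length fs * (D * e) + (D - 1)" for z
            unfolding exponents_bounded_def by blast
          moreover have "length fs * (D * e) + (D - 1) < D * C"
            using D by (simp add: C_def len algebra_simps)
          ultimately have "lookup m z < D * C" for z
            by (rule le_less_trans)
          with keys_m have "m \<in> J"
            by (simp add: J_def monomials_below_def)
          with False show False ..
        qed
        then show ?thesis by simp
      qed
      with p show "lookup ?p m = lookup 0 m" by simp
    qed
    finally show ?thesis .
  qed
  have "c \<alpha> = 0" if "\<alpha> \<in> exponents D n" for \<alpha>
  proof (rule power_products_independent_along_chain[of fs Q K V A D c])
    show "Q i \<subseteq> Q (Suc i) \<and> fs ! i \<in> Q (Suc i) - Q i" if "i < length fs" for i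
      using that strict[of i] f[of i] by (auto simp: len nth)
    show "A \<subseteq> carrier ?R"
    proof
      fix p assume "p \<in> A"
      then have "\<forall>m\<in>keys p. keys m \<subseteq> ?W"
        unfolding A_def using U by blast
      then show "p \<in> carrier ?R" by (simp only: in_carrier_poly_ring_iff)
    qed
    show "A \<inter> Q (length fs) \<subseteq> {0}"
      unfolding A_def len using free by blast
    show "c \<alpha> \<in> A" for \<alpha>
    proof -
      have "keys m \<subseteq> U" if "m \<in> keys (c \<alpha>)" for m
      proof -
        obtain \<beta> where "\<beta> \<in> monomials_below U D" "m \<in> keys (single \<beta> (k (\<alpha>, \<beta>)))"
          using subsetD[OF Poly_Mapping.keys_sum \<open>m \<in> keys (c \<alpha>)\<close>[unfolded c_def]] by blast
        then show ?thesis
          by (simp add: monomials_below_def split: if_splits)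
      qed
      then show ?thesis by (simp add: A_def)
    qed
    show "(\<Sum>\<alpha>\<in>exponents D (length fs). c \<alpha> * power_product fs \<alpha>) \<in> Q 0"
      using relation ideal_poly_ring_closed(2)[OF primeideal.axioms(1)[OF prime[of 0]]] by (simp add: len)
  qed (use that prime in \<open>auto simp: len A_def\<close>)
  moreover have "lookup (c \<alpha>) \<beta> = k (\<alpha>, \<beta>)" if "\<beta> \<in> monomials_below U D" for \<alpha> \<beta>
    using that monomials_below[OF U_fin D] by (simp add: c_def lookup_sum lookup_single when_def)
  ultimately have "k (\<alpha>, \<beta>) = 0" if "(\<alpha>, \<beta>) \<in> I" for \<alpha> \<beta>
    using that by (metis I_def SigmaE2 lookup_zero)
  with k show False by auto
qed

section \<open>Heights of toric primes\<close>

definition has_prime_chain :: "('a, 'b) ring_scheme \<Rightarrow> 'a set \<Rightarrow> nat \<Rightarrow> bool" where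
  "has_prime_chain R P n \<longleftrightarrow>
     (\<exists>Q :: nat \<Rightarrow> 'a set. (\<forall>i\<le>n. primeideal (Q i) R) \<and> (\<forall>i<n. Q i \<subset> Q (Suc i)) \<and> Q n = P)"

lemma prime_height_eqI:
  assumes "has_prime_chain R P h" "\<And>n. has_prime_chain R P n \<Longrightarrow> n \<le> h"
  shows "prime_height R P = enat h"
proof -
  have "prime_height R P = (SUP n \<in> {n. has_prime_chain R P n}. enat n)"
    by (simp add: prime_height_def has_prime_chain_def)
  also have "\<dots> = enat h"
    using assms by (intro antisym SUP_least SUP_upper) auto
  finally show ?thesis .
qed

lemma has_prime_chain_0: "primeideal P R \<Longrightarrow> has_prime_chain R P 0"
  unfolding has_prime_chain_def by (intro exI[of _ "\<lambda>_. P"]) simp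

lemma has_prime_chain_Suc:
  assumes "has_prime_chain R P n" "P \<subset> P'" "primeideal P' R"
  shows "has_prime_chain R P' (Suc n)"
proof -
  from assms(1) obtain Q where Q: "\<forall>i\<le>n. primeideal (Q i) R" "\<forall>i<n. Q i \<subset> Q (Suc i)" "Q n = P"
    unfolding has_prime_chain_def by blast
  have "\<forall>i\<le>Suc n. primeideal ((Q(Suc n := P')) i) R"
    using Q(1) assms(3) by (simp add: le_Suc_eq)
  moreover have "\<forall>i<Suc n. (Q(Suc n := P')) i \<subset> (Q(Suc n := P')) (Suc i)"
    using Q(2,3) assms(2) by (simp add: less_Suc_eq)
  ultimately show ?thesis
    unfolding has_prime_chain_def by (intro exI[of _ "Q(Suc n := P')"]) simp
qed

definition edge_binomial :: "'k::field itself \<Rightarrow> 'v \<Rightarrow> 'v \<Rightarrow> ('v, 'k) mpoly" where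
  "edge_binomial K i j = var K (X i) * var K (Y j) - var K (X j) * var K (Y i)"

lemma edge_binomial_eq:
  "edge_binomial K i j =
     single (single (X i) 1 + single (Y j) 1) 1 - single (single (X j) 1 + single (Y i) 1) 1"
  by (simp add: edge_binomial_def var_def mult_single)

lemma edge_binomial_in_carrier:
  "i \<in> V \<Longrightarrow> j \<in> V \<Longrightarrow> edge_binomial K i j \<in> carrier (poly_ring K V)"
  unfolding edge_binomial_eq
  by (intro diff_in_carrier single_in_carrier_poly_ring) (auto simp: keys_add_nat)

text \<open>
  The two monomials have the same slots, with one token on \<open>i\<close> in the first and on \<open>j\<close> in the
  second.
\<close>

lemma edge_binomial_in_toric_prime_iff:
  fixes K :: "'k::field itself"
  assumes V: "finite V" "i \<in> V" "j \<in> V"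
    and alive: "X i \<notin> Z" "X j \<notin> Z" "Y i \<notin> Z" "Y j \<notin> Z"
  shows "edge_binomial K i j \<in> toric_prime K V Z r \<longleftrightarrow> r i = r j"
proof -
  let ?m = "single (X i) 1 + single (Y j) (1::nat)" and ?n = "single (X j) 1 + single (Y i) (1::nat)"
  have sum: "(\<Sum>k | k \<in> V \<and> r k = c. lookup (single (X i) 1 + single (Y j) (1::nat)) (X k)) =
      (if r i = c then 1 else 0)" if "i \<in> V" for i j c
  proof -
    have "(\<Sum>k | k \<in> V \<and> r k = c. lookup (single (X i) 1 + single (Y j) (1::nat)) (X k)) =
        (\<Sum>k | k \<in> V \<and> r k = c. if k = i then 1 else 0)"
      by (intro sum.cong refl) (auto simp: lookup_add lookup_single when_def)
    also have "\<dots> = (if r i = c then 1 else 0)"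
      using V(1) that by simp
    finally show ?thesis .
  qed
  have "weight V r ?m = weight V r ?n \<longleftrightarrow> r i = r j"
    unfolding weight_eq_iff[OF V(1)] using V
    by (auto simp: sum lookup_add lookup_single when_def)
  moreover have "contract (invariant V Z r) (edge_binomial K i j) =
      single (weight V r ?m) 1 - single (weight V r ?n) 1"
    using alive by (simp add: edge_binomial_eq contract_diff contract_single invariant_def keys_add_nat)
  moreover have "single a (1::'k) - single b 1 = 0 \<longleftrightarrow> a = b" for a b :: "'a indet \<Rightarrow>\<^sub>0 nat"
    by (metis eq_iff_diff_eq_0 lookup_single_eq lookup_single_not_eq zero_neq_one)
  ultimately show ?thesis
    using V edge_binomial_in_carrier[of i V j K] by (simp add: toric_prime_def)
qed

text \<open>
  A class of \<open>r'\<close> is a union of classes of \<open>r\<close>, so its number of tokens is the sum of theirs.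
\<close>

lemma weight_eq_coarsen:
  assumes V: "finite V" and h: "\<And>k l. k \<in> V \<Longrightarrow> l \<in> V \<Longrightarrow> r k = r l \<Longrightarrow> r' k = r' l"
    and eq: "weight V r m = weight V r n"
  shows "weight V r' m = weight V r' n"
proof -
  have "(\<Sum>k | k \<in> V \<and> r' k = c. lookup m (X k)) = (\<Sum>k | k \<in> V \<and> r' k = c. lookup n (X k))" for c
  proof -
    let ?S = "{k \<in> V. r' k = c}"
    have S: "(\<Sum>k\<in>?S. lookup m (X k)) = (\<Sum>d\<in>r ` ?S. \<Sum>k | k \<in> V \<and> r k = d. lookup m (X k))"
      for m :: "'a indet \<Rightarrow>\<^sub>0 nat"
    proof -
      have "{k \<in> ?S. r k = d} = {k. k \<in> V \<and> r k = d}" if d: "d \<in> r ` ?S" for d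
        using d h by blast
      then show ?thesis
        using V by (subst sum.image_gen[of ?S _ r]) auto
    qed
    show ?thesis
      unfolding S using eq unfolding weight_eq_iff[OF V] by simp
  qed
  with eq show ?thesis
    unfolding weight_eq_iff[OF V] by blast
qed

text \<open>
  Splitting the single vertex \<open>i\<close> off its class makes the invariant finer and the prime smaller. The
  binomial of \<open>i\<close> and its representative \<open>r i\<close> tells the two primes apart.
\<close>

lemma toric_prime_split_strict:
  fixes K :: "'k::field itself" and V :: "'v::linorder set"
  assumes V: "finite V" and idem: "\<And>k. k \<in> V \<Longrightarrow> r k \<in> V \<and> r (r k) = r k"
    and i: "i \<in> V" "r i \<noteq> i"
  shows "toric_prime K V {} (r(i := i)) \<subset> toric_prime K V {} r"
proof -
  have "toric_prime K V {} (r(i := i)) \<subseteq> toric_prime K V {} r"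
  proof (rule toric_prime_mono)
    fix m n :: "'v indet \<Rightarrow>\<^sub>0 nat"
    assume "invariant V {} (r(i := i)) m = invariant V {} (r(i := i)) n"
    then have "weight V (r(i := i)) m = weight V (r(i := i)) n"
      by (simp add: invariant_def)
    then have "weight V r m = weight V r n"
    proof (rule weight_eq_coarsen[OF V, rotated])
      fix k l assume "k \<in> V" "l \<in> V" "(r(i := i)) k = (r(i := i)) l"
      then show "r k = r l"
        using idem by (metis fun_upd_apply)
    qed
    then show "invariant V {} r m = invariant V {} r n"
      by (simp add: invariant_def)
  qed (simp add: invariant_def)
  moreover have "edge_binomial K i (r i) \<in> toric_prime K V {} r"
    using V idem[OF i(1)] i by (subst edge_binomial_in_toric_prime_iff) auto
  moreover have "edge_binomial K i (r i) \<notin> toric_prime K V {} (r(i := i))"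
    using V idem[OF i(1)] i by (subst edge_binomial_in_toric_prime_iff) auto
  ultimately show ?thesis by blast
qed

text \<open>
  Since \<open>s\<close> forms a class of its own, the weight determines the exponents of \<open>X s\<close> and \<open>Y s\<close>, hence
  whether the monomial survives once \<open>z\<close> is killed as well.
\<close>

lemma toric_prime_kill_strict:
  fixes K :: "'k::field itself" and V :: "'v::linorder set"
  assumes V: "finite V" and s: "s \<in> V" "\<And>k. k \<in> V \<Longrightarrow> r k = s \<longleftrightarrow> k = s"
    and z: "z = X s \<or> z = Y s" "z \<notin> Z"
  shows "toric_prime K V Z r \<subset> toric_prime K V (insert z Z) r"
proof -
  have s_class: "{k. k \<in> V \<and> r k = s} = {s}" using s by auto
  have "toric_prime K V Z r \<subseteq> toric_prime K V (insert z Z) r"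
  proof (rule toric_prime_mono)
    fix m n :: "'v indet \<Rightarrow>\<^sub>0 nat"
    assume eq: "invariant V Z r m = invariant V Z r n"
    show "invariant V (insert z Z) r m = invariant V (insert z Z) r n"
    proof (cases "keys m \<inter> Z = {}")
      case True
      with eq have n: "keys n \<inter> Z = {}" and w: "weight V r m = weight V r n"
        by (auto simp: invariant_def split: if_splits)
      from w have "lookup m (X s) + lookup m (Y s) = lookup n (X s) + lookup n (Y s)"
        and "(\<Sum>k | k \<in> V \<and> r k = s. lookup m (X k)) = (\<Sum>k | k \<in> V \<and> r k = s. lookup n (X k))"
        unfolding weight_eq_iff[OF V] by blast+
      then have "z \<in> keys m \<longleftrightarrow> z \<in> keys n"
        using z(1) by (auto simp: s_class in_keys_iff)
      with True n w show ?thesis by (simp add: invariant_def)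
    next
      case False
      with eq show ?thesis by (auto simp: invariant_def split: if_splits)
    qed
  qed (auto simp: invariant_def split: if_splits)
  moreover have "z \<in> X ` V \<union> Y ` V" using s z by auto
  ultimately show ?thesis
    using var_in_toric_prime_iff[of z V K Z r] var_in_toric_prime_iff[of z V K "insert z Z" r] z(2)
    by blast
qed

text \<open>
  Start from the discrete partition, merge one vertex at a time into its class, and then kill the
  variables \<open>Y s\<close>, \<open>X s\<close> for \<open>s \<in> S\<close> one after the other. Each vertex that does not represent its class
  contributes one step, and each element of \<open>S\<close> contributes two.
\<close>

lemma has_prime_chain_toric_prime:
  fixes K :: "'k::field itself" and V :: "'v::linorder set"
  assumes V: "finite V" and idem: "\<And>k. k \<in> V \<Longrightarrow> r k \<in> V \<and> r (r k) = r k"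
    and S: "S \<subseteq> V" "\<And>s k. s \<in> S \<Longrightarrow> k \<in> V \<Longrightarrow> r k = s \<longleftrightarrow> k = s"
  shows "has_prime_chain (poly_ring K V) (toric_prime K V (X ` S \<union> Y ` S) r)
    (card {i \<in> V. r i \<noteq> i} + 2 * card S)"
proof -
  note prime = primeideal_toric_prime[OF V, where K = K]
  have base: "has_prime_chain (poly_ring K V) (toric_prime K V {} r) n"
    if "n = card {i \<in> V. r i \<noteq> i}" "\<And>k. k \<in> V \<Longrightarrow> r k \<in> V \<and> r (r k) = r k" for n r
    using that
  proof (induction n arbitrary: r)
    case 0
    then show ?case by (intro has_prime_chain_0 prime)
  next
    case (Suc n)
    then have "{i \<in> V. r i \<noteq> i} \<noteq> {}" by force
    then obtain i where i: "i \<in> V" "r i \<noteq> i" by auto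
    have "{k \<in> V. (r(i := i)) k \<noteq> k} = {i \<in> V. r i \<noteq> i} - {i}" by auto
    then have "card {k \<in> V. (r(i := i)) k \<noteq> k} = n"
      using Suc.prems(1) V i by simp
    moreover have "(r(i := i)) k \<in> V \<and> (r(i := i)) ((r(i := i)) k) = (r(i := i)) k" if "k \<in> V" for k
      using Suc.prems(2)[OF that] i by (auto simp: fun_upd_def)
    ultimately have "has_prime_chain (poly_ring K V) (toric_prime K V {} (r(i := i))) n"
      by (intro Suc.IH) auto
    then show ?case
      using toric_prime_split_strict[OF V Suc.prems(2) i] prime by (rule has_prime_chain_Suc)
  qed
  have "finite S" using S(1) V by (rule finite_subset)
  then show ?thesis using S
  proof (induction S rule: finite_induct)
    case empty
    then show ?case using base[OF refl idem] by simp
  next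
    case (insert s S)
    let ?Z = "X ` S \<union> Y ` S"
    have s: "s \<in> V" "\<And>k. k \<in> V \<Longrightarrow> r k = s \<longleftrightarrow> k = s" using insert.prems by auto
    have "has_prime_chain (poly_ring K V) (toric_prime K V ?Z r) (card {i \<in> V. r i \<noteq> i} + 2 * card S)"
      using insert.prems by (intro insert.IH) auto
    then have "has_prime_chain (poly_ring K V) (toric_prime K V (insert (Y s) ?Z) r)
        (Suc (card {i \<in> V. r i \<noteq> i} + 2 * card S))"
    proof (rule has_prime_chain_Suc[OF _ toric_prime_kill_strict[OF V s] prime])
      show "Y s \<notin> ?Z" using insert.hyps by auto
    qed simp_all
    then have "has_prime_chain (poly_ring K V) (toric_prime K V (insert (X s) (insert (Y s) ?Z)) r)
        (Suc (Suc (card {i \<in> V. r i \<noteq> i} + 2 * card S)))"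
    proof (rule has_prime_chain_Suc[OF _ toric_prime_kill_strict[OF V s] prime])
      show "X s \<notin> insert (Y s) ?Z" using insert.hyps by auto
    qed simp_all
    moreover have "insert (X s) (insert (Y s) ?Z) = X ` insert s S \<union> Y ` insert s S" by auto
    moreover have "Suc (Suc (card {i \<in> V. r i \<noteq> i} + 2 * card S)) =
        card {i \<in> V. r i \<noteq> i} + 2 * card (insert s S)"
      using insert.hyps by simp
    ultimately show ?case by simp
  qed
qed

lemma contract_Some: "contract Some p = p"
  using poly_mapping_eq_sum_single[of "keys p" p] by (simp add: contract_def)

text \<open>
  Monomials in these variables are determined by their weight: every vertex outside \<open>S\<close> has its \<open>X\<close>,
  and at most one vertex in each class has its \<open>Y\<close>. At the other vertices the number of slots is the
  exponent of \<open>X\<close>, and then the number of tokens on the class gives the remaining exponent.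
\<close>

lemma toric_prime_free_variables:
  fixes K :: "'k::field itself" and V :: "'v::linorder set"
  assumes V: "finite V"
    and p: "p \<in> toric_prime K V (X ` S \<union> Y ` S) r"
    and keys: "\<And>m. m \<in> keys p \<Longrightarrow> keys m \<subseteq> X ` (V - S) \<union> Y ` {t \<in> V - S. r t = t}"
  shows "p = 0"
proof -
  let ?\<kappa> = "invariant V (X ` S \<union> Y ` S) r"
  have alive: "?\<kappa> m = Some (weight V r m)" if "m \<in> keys p" for m
    using keys[OF that] by (auto simp: invariant_def)
  have "m = n" if m: "m \<in> keys p" and n: "n \<in> keys p" and eq: "?\<kappa> m = ?\<kappa> n" for m n
  proof -
    from eq alive m n have w: "weight V r m = weight V r n" by simp
    have deg: "lookup m (X i) + lookup m (Y i) = lookup n (X i) + lookup n (Y i)" for i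
      using w unfolding weight_eq_iff[OF V] by blast
    have zero: "lookup m z = 0" if "m \<in> keys p" "z \<notin> X ` (V - S) \<union> Y ` {t \<in> V - S. r t = t}" for m z
    proof -
      have "z \<notin> keys m" using keys[OF that(1)] that(2) by blast
      then show ?thesis by (simp add: in_keys_iff)
    qed
    have X1: "lookup m (X i) = lookup n (X i)" if "\<not> (i \<in> V - S \<and> r i = i)" for i
    proof -
      have "Y i \<notin> X ` (V - S) \<union> Y ` {t \<in> V - S. r t = t}" using that by auto
      then show ?thesis using deg[of i] zero[OF m] zero[OF n] by simp
    qed
    have X2: "lookup m (X t) = lookup n (X t)" if "t \<in> V - S" "r t = t" for t
    proof -
      have "(\<Sum>k | k \<in> V \<and> r k = t. lookup m (X k)) = (\<Sum>k | k \<in> V \<and> r k = t. lookup n (X k))"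
        using w unfolding weight_eq_iff[OF V] by blast
      moreover have "(\<Sum>k\<in>{k. k \<in> V \<and> r k = t} - {t}. lookup m (X k)) =
          (\<Sum>k\<in>{k. k \<in> V \<and> r k = t} - {t}. lookup n (X k))"
        by (intro sum.cong refl X1) auto
      ultimately show ?thesis
        using that V by (simp add: sum.remove[of "{k. k \<in> V \<and> r k = t}" t])
    qed
    have "lookup m (X i) = lookup n (X i)" for i using X1 X2 by blast
    moreover from this deg have "lookup m (Y i) = lookup n (Y i)" for i
      by (metis add_left_cancel)
    ultimately show "m = n"
      by (intro poly_mapping_eqI) (case_tac k; simp)
  qed
  moreover have "contract ?\<kappa> p = 0" using p by (simp add: toric_prime_def)
  ultimately have "contract Some p = 0"
    by (intro contract_eq_0_mono[of p ?\<kappa> Some]) (simp_all add: alive)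
  then show ?thesis by (simp add: contract_Some)
qed

text \<open>
  The variables of \<open>toric_prime_free_variables\<close> bound the lengths of chains from above, and the
  bound is attained by \<open>has_prime_chain_toric_prime\<close>.
\<close>

theorem prime_height_toric_prime:
  fixes K :: "'k::field itself" and V :: "'v::linorder set"
  assumes V: "finite V" and idem: "\<And>k. k \<in> V \<Longrightarrow> r k \<in> V \<and> r (r k) = r k"
    and S: "S \<subseteq> V" "\<And>s k. s \<in> S \<Longrightarrow> k \<in> V \<Longrightarrow> r k = s \<longleftrightarrow> k = s"
  shows "prime_height (poly_ring K V) (toric_prime K V (X ` S \<union> Y ` S) r) =
    enat (card {i \<in> V. r i \<noteq> i} + 2 * card S)"
proof (rule prime_height_eqI)
  show "has_prime_chain (poly_ring K V) (toric_prime K V (X ` S \<union> Y ` S) r)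
      (card {i \<in> V. r i \<noteq> i} + 2 * card S)"
    by (rule has_prime_chain_toric_prime) fact+
next
  fix n assume "has_prime_chain (poly_ring K V) (toric_prime K V (X ` S \<union> Y ` S) r) n"
  then obtain Q where Q: "\<forall>i\<le>n. primeideal (Q i) (poly_ring K V)" "\<forall>i<n. Q i \<subset> Q (Suc i)"
    "Q n = toric_prime K V (X ` S \<union> Y ` S) r"
    unfolding has_prime_chain_def by blast
  let ?T = "{t \<in> V - S. r t = t}"
  have fin: "finite S" "finite ?T"
    using S(1) V by (auto intro: finite_subset)
  have "n + card (X ` (V - S) \<union> Y ` ?T) \<le> 2 * card V"
  proof (rule prime_chain_length_le[OF V, of _ n Q K])
    show "p = 0" if "p \<in> Q n" "\<And>m. m \<in> keys p \<Longrightarrow> keys m \<subseteq> X ` (V - S) \<union> Y ` ?T" for p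
      using toric_prime_free_variables[OF V, of p K S r] that Q(3) by blast
  qed (use Q in auto)
  moreover have "card (X ` (V - S) \<union> Y ` ?T) = card V - card S + card ?T"
  proof -
    have "card (X ` (V - S) \<union> Y ` ?T) = card (X ` (V - S)) + card (Y ` ?T)"
      using V by (intro card_Un_disjoint) auto
    then show ?thesis
      using S(1) fin by (simp add: card_image inj_on_def card_Diff_subset)
  qed
  moreover have "card S \<le> card V"
    using V S(1) by (rule card_mono)
  moreover have "card V = card {i \<in> V. r i \<noteq> i} + (card S + card ?T)"
  proof -
    have "V = {i \<in> V. r i \<noteq> i} \<union> (S \<union> ?T)" using S by auto
    then have "card V = card ({i \<in> V. r i \<noteq> i} \<union> (S \<union> ?T))" by simp
    also have "\<dots> = card {i \<in> V. r i \<noteq> i} + card (S \<union> ?T)"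
      using V fin S by (intro card_Un_disjoint) auto
    also have "card (S \<union> ?T) = card S + card ?T"
      using fin by (intro card_Un_disjoint) auto
    finally show ?thesis .
  qed
  ultimately show "n \<le> card {i \<in> V. r i \<noteq> i} + 2 * card S" by simp
qed

section \<open>Components after deleting vertices\<close>

definition arcs_avoiding :: "'v pair_pre_digraph \<Rightarrow> 'v set \<Rightarrow> ('v \<times> 'v) set" where
  "arcs_avoiding G S = {(i, j) \<in> parcs G. i \<notin> S \<and> j \<notin> S}"

text \<open>
  For \<open>i \<in> S\<close> this is the singleton \<open>{i}\<close>, which is not a component of \<open>G - S\<close>.
\<close>

definition component :: "'v pair_pre_digraph \<Rightarrow> 'v set \<Rightarrow> 'v \<Rightarrow> 'v set" where
  "component G S i = {j. (i, j) \<in> (arcs_avoiding G S)\<^sup>*}"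

definition components :: "'v pair_pre_digraph \<Rightarrow> 'v set \<Rightarrow> 'v set set" where
  "components G S = component G S ` (pverts G - S)"

definition comp_rep :: "'v pair_pre_digraph \<Rightarrow> 'v set \<Rightarrow> 'v \<Rightarrow> 'v" where
  "comp_rep G S i = (SOME j. j \<in> component G S i)"

lemma pair_graph_arcs:
  assumes "pair_graph G"
  shows "finite (pverts G)"
    and "(i, j) \<in> parcs G \<Longrightarrow> i \<in> pverts G \<and> j \<in> pverts G \<and> i \<noteq> j \<and> (j, i) \<in> parcs G"
  using assms by (auto simp: pair_graph_iff dest: symD irreflD)

lemma sym_arcs_avoiding: "pair_graph G \<Longrightarrow> sym (arcs_avoiding G S)"
  by (auto intro!: symI simp: arcs_avoiding_def dest: pair_graph_arcs(2))

lemma linked_sym: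
  "pair_graph G \<Longrightarrow> (i, j) \<in> (arcs_avoiding G S)\<^sup>* \<Longrightarrow> (j, i) \<in> (arcs_avoiding G S)\<^sup>*"
  using sym_rtrancl[OF sym_arcs_avoiding] by (metis symD)

lemma component_eq_iff:
  assumes "pair_graph G"
  shows "component G S i = component G S j \<longleftrightarrow> (i, j) \<in> (arcs_avoiding G S)\<^sup>*"
proof
  assume "component G S i = component G S j"
  then have "j \<in> component G S i" by (simp add: component_def)
  then show "(i, j) \<in> (arcs_avoiding G S)\<^sup>*" by (simp add: component_def)
next
  assume ij: "(i, j) \<in> (arcs_avoiding G S)\<^sup>*"
  then show "component G S i = component G S j"
    using linked_sym[OF assms ij] by (auto simp: component_def intro: rtrancl_trans)
qed

lemma comp_rep_linked: "(i, comp_rep G S i) \<in> (arcs_avoiding G S)\<^sup>*"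
proof -
  have "comp_rep G S i \<in> component G S i"
    unfolding comp_rep_def by (rule someI[of _ i]) (simp add: component_def)
  then show ?thesis by (simp add: component_def)
qed

lemma comp_rep_eq_iff:
  assumes "pair_graph G"
  shows "comp_rep G S i = comp_rep G S j \<longleftrightarrow> (i, j) \<in> (arcs_avoiding G S)\<^sup>*"
proof
  assume "comp_rep G S i = comp_rep G S j"
  then show "(i, j) \<in> (arcs_avoiding G S)\<^sup>*"
    using comp_rep_linked[of i G S] linked_sym[OF assms comp_rep_linked[of j G S]]
    by (auto intro: rtrancl_trans)
next
  assume "(i, j) \<in> (arcs_avoiding G S)\<^sup>*"
  then have "component G S i = component G S j"
    by (simp add: component_eq_iff[OF assms])
  then show "comp_rep G S i = comp_rep G S j"
    by (simp add: comp_rep_def)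
qed

lemma linked_in_pverts:
  assumes "pair_graph G" "(i, j) \<in> (arcs_avoiding G S)\<^sup>*"
  shows "i \<in> pverts G \<Longrightarrow> j \<in> pverts G" "i \<in> S \<or> j \<in> S \<Longrightarrow> i = j"
  using assms(2)
  by (induction rule: rtrancl_induct) (auto simp: arcs_avoiding_def dest: pair_graph_arcs(2)[OF assms(1)])

lemma comp_rep:
  assumes "pair_graph G"
  shows "i \<in> pverts G \<Longrightarrow> comp_rep G S i \<in> pverts G"
    and "comp_rep G S (comp_rep G S i) = comp_rep G S i"
    and "s \<in> S \<Longrightarrow> comp_rep G S k = s \<longleftrightarrow> k = s"
proof -
  show "i \<in> pverts G \<Longrightarrow> comp_rep G S i \<in> pverts G"
    by (rule linked_in_pverts(1)[OF assms comp_rep_linked])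
  show "comp_rep G S (comp_rep G S i) = comp_rep G S i"
    unfolding comp_rep_eq_iff[OF assms] by (rule linked_sym[OF assms comp_rep_linked])
  show "s \<in> S \<Longrightarrow> comp_rep G S k = s \<longleftrightarrow> k = s"
    using linked_in_pverts(2)[OF assms comp_rep_linked] by metis
qed

text \<open>
  Each component contains exactly one vertex that represents it, and the elements of \<open>S\<close> represent
  themselves.
\<close>

lemma card_components:
  assumes G: "pair_graph G" and S: "S \<subseteq> pverts G"
  shows "card {i \<in> pverts G. comp_rep G S i \<noteq> i} + card S + card (components G S) = card (pverts G)"
proof -
  let ?V = "pverts G" and ?r = "comp_rep G S"
  let ?T = "{t \<in> ?V - S. ?r t = t}"
  have fin: "finite ?V" "finite S"
    using pair_graph_arcs(1)[OF G] S by (auto intro: finite_subset)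
  have "bij_betw (component G S) ?T (components G S)"
    unfolding bij_betw_def
  proof
    show "inj_on (component G S) ?T"
      by (rule inj_onI) (auto simp: component_eq_iff[OF G] simp flip: comp_rep_eq_iff[OF G])
    have "component G S i \<in> component G S ` ?T" if "i \<in> ?V - S" for i
    proof (rule image_eqI)
      show "component G S i = component G S (?r i)"
        unfolding component_eq_iff[OF G] by (rule comp_rep_linked)
      have "?r i \<notin> S" using that comp_rep(3)[OF G, of "?r i" S i] by auto
      then show "?r i \<in> ?T" using that comp_rep(1,2)[OF G] by auto
    qed
    then show "component G S ` ?T = components G S" by (auto simp: components_def)
  qed
  then have "card ?T = card (components G S)" by (rule bij_betw_same_card)
  moreover have "card ?V = card {i \<in> ?V. ?r i \<noteq> i} + (card S + card ?T)"
  proof -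
    have "?V = {i \<in> ?V. ?r i \<noteq> i} \<union> (S \<union> ?T)" using S comp_rep(3)[OF G] by auto
    then have "card ?V = card ({i \<in> ?V. ?r i \<noteq> i} \<union> (S \<union> ?T))" by simp
    also have "\<dots> = card {i \<in> ?V. ?r i \<noteq> i} + card (S \<union> ?T)"
      using fin comp_rep(3)[OF G] by (intro card_Un_disjoint) auto
    also have "card (S \<union> ?T) = card S + card ?T"
      using fin by (intro card_Un_disjoint) auto
    finally show ?thesis .
  qed
  ultimately show ?thesis by simp
qed

text \<open>
  In the usual notation this is \<open>(x\<^sub>i, y\<^sub>i : i \<in> S) + \<Sum>\<^sub>C J\<^sub>C\<close>, where \<open>C\<close> runs over the complete graphs
  on the components of \<open>G - S\<close>.
\<close>

definition component_prime :: "'k::field itself \<Rightarrow> 'v pair_pre_digraph \<Rightarrow> 'v set \<Rightarrow> ('v, 'k) mpoly set" where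
  "component_prime K G S = toric_prime K (pverts G) (X ` S \<union> Y ` S) (comp_rep G S)"

lemma primeideal_component_prime:
  fixes G :: "'v::linorder pair_pre_digraph"
  shows "pair_graph G \<Longrightarrow> primeideal (component_prime K G S) (poly_ring K (pverts G))"
  unfolding component_prime_def by (intro primeideal_toric_prime pair_graph_arcs(1))

lemma prime_height_component_prime:
  fixes G :: "'v::linorder pair_pre_digraph"
  assumes "pair_graph G" "S \<subseteq> pverts G"
  shows "\<exists>h. prime_height (poly_ring K (pverts G)) (component_prime K G S) = enat h \<and>
    h + card (components G S) = card (pverts G) + card S"
proof -
  have "prime_height (poly_ring K (pverts G)) (component_prime K G S) =
      enat (card {i \<in> pverts G. comp_rep G S i \<noteq> i} + 2 * card S)"
    unfolding component_prime_def
    by (rule prime_height_toric_prime) (use assms in \<open>auto simp: comp_rep pair_graph_arcs\<close>)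
  with card_components[OF assms] show ?thesis by auto
qed

section \<open>The binomial edge ideal as an intersection\<close>

lemma edge_binomial_in_ideal:
  assumes G: "pair_graph G" and ij: "(i, j) \<in> parcs G"
  shows "edge_binomial K i j \<in> binomial_edge_ideal K (G :: 'v::linorder pair_pre_digraph)"
proof -
  interpret cring "poly_ring K (pverts G)" by (rule cring_poly_ring)
  let ?B = "{edge_binomial K i j | i j. (i, j) \<in> parcs G \<and> i < j}"
  have J: "binomial_edge_ideal K G = Idl\<^bsub>poly_ring K (pverts G)\<^esub> ?B"
    by (simp add: binomial_edge_ideal_def edge_binomial_def)
  have "?B \<subseteq> carrier (poly_ring K (pverts G))"
    using pair_graph_arcs(2)[OF G] by (auto intro: edge_binomial_in_carrier)
  then have sub: "?B \<subseteq> binomial_edge_ideal K G"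
    unfolding J by (rule genideal_self)
  show ?thesis
  proof (cases "i < j")
    case True
    with ij sub show ?thesis by blast
  next
    case False
    with pair_graph_arcs(2)[OF G ij] have "(j, i) \<in> parcs G" "j < i" by auto
    then have "edge_binomial K j i \<in> ?B" by blast
    then have "- edge_binomial K j i \<in> binomial_edge_ideal K G"
      using sub ideal_poly_ring_closed(4)[OF ideal_binomial_edge_ideal[OF G]] by blast
    moreover have "- edge_binomial K j i = edge_binomial K i j"
      by (simp add: edge_binomial_def mult.commute)
    ultimately show ?thesis by simp
  qed
qed

text \<open>
  An edge that meets \<open>S\<close> has both terms of its binomial killed; any other edge lies inside one
  component.
\<close>

lemma binomial_edge_ideal_subset_component_prime:
  fixes G :: "'v::linorder pair_pre_digraph"
  assumes G: "pair_graph G"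
  shows "binomial_edge_ideal K G \<subseteq> component_prime K G S"
proof -
  interpret cring "poly_ring K (pverts G)" by (rule cring_poly_ring)
  have "edge_binomial K i j \<in> component_prime K G S" if ij: "(i, j) \<in> parcs G" for i j
  proof -
    note V = pair_graph_arcs(1)[OF G] and ij' = pair_graph_arcs(2)[OF G ij]
    show ?thesis
    proof (cases "i \<in> S \<or> j \<in> S")
      case True
      then have "contract (invariant (pverts G) (X ` S \<union> Y ` S) (comp_rep G S)) (edge_binomial K i j) = 0"
        by (auto simp: edge_binomial_eq contract_diff contract_single invariant_def keys_add_nat)
      then show ?thesis
        using ij' edge_binomial_in_carrier[of i "pverts G" j K]
        by (simp add: component_prime_def toric_prime_def)
    next
      case False
      then have "(i, j) \<in> (arcs_avoiding G S)\<^sup>*"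
        using ij by (auto simp: arcs_avoiding_def)
      then show ?thesis
        unfolding component_prime_def
        using False ij' V by (subst edge_binomial_in_toric_prime_iff) (auto simp: comp_rep_eq_iff[OF G])
    qed
  qed
  then have "{edge_binomial K i j | i j. (i, j) \<in> parcs G \<and> i < j} \<subseteq> component_prime K G S"
    by blast
  then show ?thesis
    unfolding binomial_edge_ideal_def edge_binomial_def[symmetric]
    by (intro genideal_minimal primeideal.axioms(1) primeideal_component_prime G)
qed

abbreviation vertex_degree :: "('v indet \<Rightarrow>\<^sub>0 nat) \<Rightarrow> 'v \<Rightarrow> nat" where
  "vertex_degree m i \<equiv> lookup m (X i) + lookup m (Y i)"

text \<open>
  A token moves from \<open>i\<close> to \<open>j\<close> although the vertices in between may be full. Induct along the path, whose
  first edge leads from \<open>i\<close> to \<open>k\<close>. If \<open>k\<close> has a free slot, move the token to \<open>k\<close> and on to \<open>j\<close>;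
  otherwise \<open>k\<close> has a token, which first moves to \<open>j\<close> and is then replaced by the token from \<open>i\<close>.
\<close>

lemma move_along_path:
  fixes G :: "'v::linorder pair_pre_digraph" and K :: "'k::field itself"
  assumes G: "pair_graph G" and path: "(i, j) \<in> (arcs_avoiding G S)\<^sup>*"
    and q: "keys q \<subseteq> X ` pverts G \<union> Y ` pverts G"
    and pos: "\<And>k. k \<in> pverts G - S \<Longrightarrow> k \<noteq> i \<Longrightarrow> k \<noteq> j \<Longrightarrow> vertex_degree q k > 0"
  shows "single (q + single (X i) 1 + single (Y j) 1) (1::'k) - single (q + single (X j) 1 + single (Y i) 1) 1
    \<in> binomial_edge_ideal K G"
  using path q pos
proof (induction arbitrary: q rule: converse_rtrancl_induct)
  case base
  then show ?case
    using ideal_poly_ring_closed(2)[OF ideal_binomial_edge_ideal[OF G]] by simp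
next
  case (step i k)
  let ?J = "binomial_edge_ideal K G"
  note J = ideal_poly_ring_closed[OF ideal_binomial_edge_ideal[OF G, of K]]
  let ?W = "X ` pverts G \<union> Y ` pverts G"
  let ?x = "\<lambda>i. single (X i) (1::nat)" and ?y = "\<lambda>i. single (Y i) (1::nat)"
  have ik: "(i, k) \<in> parcs G" "i \<notin> S" "k \<notin> S" "i \<in> pverts G" "k \<in> pverts G" "i \<noteq> k"
    using step.hyps(1) pair_graph_arcs(2)[OF G] by (auto simp: arcs_avoiding_def)
  have edge: "single (q + ?x i + ?y k) (1::'k) - single (q + ?x k + ?y i) 1 \<in> ?J"
    if "keys q \<subseteq> ?W" for q
  proof -
    have "single q 1 * edge_binomial K i k \<in> ?J"
      using that by (intro J(6) edge_binomial_in_ideal[OF G ik(1)] single_in_carrier_poly_ring)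
    then show ?thesis
      by (simp add: edge_binomial_eq right_diff_distrib mult_single add.assoc)
  qed
  have trans: "single a (1::'k) - single c 1 \<in> ?J"
    if "single a (1::'k) - single b 1 \<in> ?J" "single b (1::'k) - single c 1 \<in> ?J" for a b c
    using J(3)[OF that] by simp
  show ?case
  proof (cases "k = i \<or> k = j")
    case True
    with edge[OF step.prems(1)] ik show ?thesis by auto
  next
    case False
    with step.prems(2)[of k] ik have "lookup q (Y k) > 0 \<or> lookup q (X k) > 0" by auto
    then show ?thesis
    proof
      assume k: "lookup q (Y k) > 0"
      define q' where "q' = q - ?y k"
      have q': "q = q' + ?y k"
        using k by (intro poly_mapping_eqI) (auto simp: q'_def lookup_add lookup_minus lookup_single when_def)
      have W: "keys q' \<subseteq> ?W" using step.prems(1) by (simp add: q' keys_add_nat)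
      have "single (q' + ?y i + ?x k + ?y j) (1::'k) - single (q' + ?y i + ?x j + ?y k) 1 \<in> ?J"
      proof (rule step.IH)
        show "keys (q' + ?y i) \<subseteq> ?W" using W ik by (auto simp: keys_add_nat)
        fix l assume "l \<in> pverts G - S" "l \<noteq> k" "l \<noteq> j"
        then show "vertex_degree (q' + ?y i) l > 0"
          using step.prems(2)[of l] by (cases "l = i") (auto simp: q' lookup_add lookup_single when_def)
      qed
      moreover have "single (q' + ?y j + ?x i + ?y k) (1::'k) - single (q' + ?y j + ?x k + ?y i) 1 \<in> ?J"
      proof (cases "j \<in> pverts G")
        case True
        then show ?thesis using W by (intro edge) (auto simp: keys_add_nat)
      next
        case False
        then show ?thesis using linked_in_pverts(1)[OF G step.hyps(2)] ik by simp
      qed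
      ultimately show ?thesis
        using trans[of "q' + ?y j + ?x i + ?y k" "q' + ?y j + ?x k + ?y i" "q' + ?y i + ?x j + ?y k"]
        by (simp add: q' add_ac)
    next
      assume k: "lookup q (X k) > 0"
      define q' where "q' = q - ?x k"
      have q': "q = q' + ?x k"
        using k by (intro poly_mapping_eqI) (auto simp: q'_def lookup_add lookup_minus lookup_single when_def)
      have W: "keys q' \<subseteq> ?W" using step.prems(1) by (simp add: q' keys_add_nat)
      have "single (q' + ?x i + ?x k + ?y j) (1::'k) - single (q' + ?x i + ?x j + ?y k) 1 \<in> ?J"
      proof (rule step.IH)
        show "keys (q' + ?x i) \<subseteq> ?W" using W ik by (auto simp: keys_add_nat)
        fix l assume "l \<in> pverts G - S" "l \<noteq> k" "l \<noteq> j"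
        then show "vertex_degree (q' + ?x i) l > 0"
          using step.prems(2)[of l] by (cases "l = i") (auto simp: q' lookup_add lookup_single when_def)
      qed
      moreover have "single (q' + ?x j + ?x i + ?y k) (1::'k) - single (q' + ?x j + ?x k + ?y i) 1 \<in> ?J"
      proof (cases "j \<in> pverts G")
        case True
        then show ?thesis using W by (intro edge) (auto simp: keys_add_nat)
      next
        case False
        then show ?thesis using linked_in_pverts(1)[OF G step.hyps(2)] ik by simp
      qed
      ultimately show ?thesis
        using trans[of "q' + ?x i + ?x k + ?y j" "q' + ?x i + ?x j + ?y k" "q' + ?x j + ?x k + ?y i"]
        by (simp add: q' add_ac)
    qed
  qed
qed

text \<open>
  If some vertex \<open>i\<close> has more tokens in \<open>m\<close> than in \<open>n\<close>, then some \<open>j\<close> in its component has fewer,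
  because the totals on the component agree. Moving one token from \<open>i\<close> to \<open>j\<close> brings \<open>m\<close> closer to \<open>n\<close>.
\<close>

lemma equal_weight_congruent:
  fixes G :: "'v::linorder pair_pre_digraph" and K :: "'k::field itself"
  assumes G: "pair_graph G"
    and keys: "keys m \<subseteq> X ` pverts G \<union> Y ` pverts G" "keys n \<subseteq> X ` pverts G \<union> Y ` pverts G"
    and pos: "\<And>k. k \<in> pverts G - S \<Longrightarrow> vertex_degree m k > 0"
    and eq: "weight (pverts G) (comp_rep G S) m = weight (pverts G) (comp_rep G S) n"
  shows "single m (1::'k) - single n 1 \<in> binomial_edge_ideal K G"
  using keys(1) pos eq
proof (induction "\<Sum>k\<in>pverts G. lookup m (X k) - lookup n (X k)" arbitrary: m rule: less_induct)
  case less
  let ?V = "pverts G" and ?r = "comp_rep G S" and ?J = "binomial_edge_ideal K G"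
  note V = pair_graph_arcs(1)[OF G]
  note J = ideal_poly_ring_closed[OF ideal_binomial_edge_ideal[OF G, of K]]
  have deg: "vertex_degree m k = vertex_degree n k" for k
    using less.prems(3) unfolding weight_eq_iff[OF V] by blast
  have tokens: "(\<Sum>k | k \<in> ?V \<and> ?r k = c. lookup m (X k)) = (\<Sum>k | k \<in> ?V \<and> ?r k = c. lookup n (X k))" for c
    using less.prems(3) unfolding weight_eq_iff[OF V] by blast
  show ?case
  proof (cases "\<exists>i\<in>?V. lookup n (X i) < lookup m (X i)")
    case False
    have X_eq: "lookup m (X k) = lookup n (X k)" for k
    proof (cases "k \<in> ?V")
      case True
      show ?thesis
        by (rule sum_mono_inv[OF tokens[of "?r k"]]) (use False V True in \<open>auto simp: not_less\<close>)
    next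
      case out: False
      then have "X k \<notin> keys m" "X k \<notin> keys n" using less.prems(1) keys(2) by auto
      then show ?thesis by (simp add: in_keys_iff)
    qed
    moreover have "lookup m (Y k) = lookup n (Y k)" for k
      using deg[of k] X_eq[of k] by simp
    ultimately have "m = n"
      by (intro poly_mapping_eqI) (case_tac k; simp)
    then show ?thesis using J(2) by simp
  next
    case True
    then obtain i where i: "i \<in> ?V" "lookup n (X i) < lookup m (X i)" by blast
    have "\<exists>j\<in>{k. k \<in> ?V \<and> ?r k = ?r i}. lookup m (X j) < lookup n (X j)"
    proof (rule ccontr)
      assume "\<not> ?thesis"
      then have "lookup n (X k) \<le> lookup m (X k)" if "k \<in> {k. k \<in> ?V \<and> ?r k = ?r i}" for k
        using that by (auto simp: not_less)
      then have "lookup n (X i) = lookup m (X i)"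
        by (rule sum_mono_inv[OF tokens[of "?r i", symmetric]]) (use i V in auto)
      with i show False by simp
    qed
    then obtain j where j: "j \<in> ?V" "?r i = ?r j" "lookup m (X j) < lookup n (X j)" by auto
    have ij: "i \<noteq> j" using i j by auto
    have path: "(i, j) \<in> (arcs_avoiding G S)\<^sup>*"
      using j(2) by (simp add: comp_rep_eq_iff[OF G])
    have yj: "lookup m (Y j) > 0" using deg[of j] j(3) by simp
    let ?x = "\<lambda>i. single (X i) (1::nat)" and ?y = "\<lambda>i. single (Y i) (1::nat)"
    define q where "q = m - (?x i + ?y j)"
    define m' where "m' = q + ?x j + ?y i"
    have m: "m = q + ?x i + ?y j"
      using i(2) yj
      by (intro poly_mapping_eqI) (auto simp: q_def lookup_add lookup_minus lookup_single when_def)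
    have q: "keys q \<subseteq> X ` ?V \<union> Y ` ?V"
      using less.prems(1) by (auto simp: m keys_add_nat)
    have "single m (1::'k) - single m' 1 \<in> ?J"
      unfolding m m'_def
    proof (rule move_along_path[OF G path q])
      fix k assume "k \<in> ?V - S" "k \<noteq> i" "k \<noteq> j"
      then show "vertex_degree q k > 0"
        using less.prems(2)[of k] by (auto simp: m lookup_add lookup_single when_def)
    qed
    moreover have "single m' (1::'k) - single n 1 \<in> ?J"
    proof (rule less.hyps)
      have X': "lookup m' (X k) = (if k = i then lookup m (X k) - 1 else
          if k = j then lookup m (X k) + 1 else lookup m (X k))" for k
        using ij by (simp add: m m'_def lookup_add lookup_single when_def)
      have deg': "vertex_degree m' k = vertex_degree m k" for k
        using ij by (auto simp: m m'_def lookup_add lookup_single when_def)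
      show "(\<Sum>k\<in>?V. lookup m' (X k) - lookup n (X k)) < (\<Sum>k\<in>?V. lookup m (X k) - lookup n (X k))"
      proof (rule sum_strict_mono_ex1[OF V])
        show "\<forall>k\<in>?V. lookup m' (X k) - lookup n (X k) \<le> lookup m (X k) - lookup n (X k)"
          using j(3) by (auto simp: X')
        show "\<exists>k\<in>?V. lookup m' (X k) - lookup n (X k) < lookup m (X k) - lookup n (X k)"
          using i by (intro bexI[of _ i]) (auto simp: X')
      qed
      show "keys m' \<subseteq> X ` ?V \<union> Y ` ?V"
        using q i j by (auto simp: m'_def keys_add_nat)
      show "vertex_degree m' k > 0" if "k \<in> ?V - S" for k
        using less.prems(2)[OF that] deg' by simp
      have "weight ?V ?r (?x i + ?y j) = weight ?V ?r (?x j + ?y i)"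
      proof -
        have "edge_binomial K i j \<in> toric_prime K ?V {} ?r"
          using V i j by (subst edge_binomial_in_toric_prime_iff) auto
        then have "single (weight ?V ?r (?x i + ?y j)) (1::'k) = single (weight ?V ?r (?x j + ?y i)) 1"
          by (simp add: toric_prime_def edge_binomial_eq contract_diff contract_single invariant_def)
        then show ?thesis
          by (metis lookup_single_eq lookup_single_not_eq zero_neq_one)
      qed
      then have "weight ?V ?r m' = weight ?V ?r m"
        by (simp add: m m'_def weight_add[OF V] add.assoc)
      with less.prems(3) show "weight ?V ?r m' = weight ?V ?r n" by simp
    qed
    ultimately have "(single m (1::'k) - single m' 1) + (single m' 1 - single n 1) \<in> ?J"
      by (rule J(3))
    then show ?thesis by simp
  qed
qed

lemma lookup_contract:
  "lookup (contract \<kappa> p) c = (\<Sum>m\<in>keys p. if \<kappa> m = Some c then lookup p m else 0)"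
  unfolding contract_def lookup_sum
  by (intro sum.cong refl) (auto simp: lookup_single when_def split: option.splits)

text \<open>
  The class of a monomial \<open>m\<close> modulo the ideal is given by its invariant for the set \<open>S m\<close> of vertices
  without slots. Since the slots are part of the weight, this is also a full class of monomials for the
  invariant that defines \<open>component_prime K G (S m)\<close>, so the coefficients of \<open>p\<close> over it add up to zero.
\<close>

lemma in_binomial_edge_ideal_if_in_component_primes:
  fixes G :: "'v::linorder pair_pre_digraph" and K :: "'k::field itself"
  assumes G: "pair_graph G"
    and p: "\<And>S. S \<subseteq> pverts G \<Longrightarrow> p \<in> component_prime K G S"
  shows "p \<in> binomial_edge_ideal K G"
proof -
  let ?V = "pverts G"
  note V = pair_graph_arcs(1)[OF G]
  define S where "S m = {k \<in> ?V. vertex_degree m k = 0}" for m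
  define \<kappa> where "\<kappa> m = weight ?V (comp_rep G (S m)) m" for m
  have p_carrier: "p \<in> carrier (poly_ring K ?V)"
    using p[of "{}"] by (simp add: component_prime_def toric_prime_def)
  then have keys: "keys m \<subseteq> X ` ?V \<union> Y ` ?V" if "m \<in> keys p" for m
    using that by (simp add: in_carrier_poly_ring_iff)
  have S_eq: "S m = S n" if "weight ?V r m = weight ?V r' n" for m n r r'
  proof -
    have "vertex_degree m k = vertex_degree n k" for k
      using arg_cong[OF that, of "\<lambda>w. lookup w (X k)"] by (simp add: lookup_weight[OF V])
    then show ?thesis by (simp add: S_def)
  qed
  show ?thesis
  proof (rule in_ideal_if_class_sums_0[OF ideal_binomial_edge_ideal[OF G] p_carrier])
    show "single m (1::'k) - single n 1 \<in> binomial_edge_ideal K G"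
      if mn: "m \<in> keys p" "n \<in> keys p" "\<kappa> m = \<kappa> n" for m n
    proof (rule equal_weight_congruent[OF G keys[OF mn(1)] keys[OF mn(2)], of "S m"])
      have "S m = S n" using mn(3) unfolding \<kappa>_def by (rule S_eq)
      then show "weight ?V (comp_rep G (S m)) m = weight ?V (comp_rep G (S m)) n"
        using mn(3) by (simp add: \<kappa>_def)
    qed (simp add: S_def)
    show "contract (\<lambda>m. Some (\<kappa> m)) p = 0"
    proof (rule poly_mapping_eqI)
      fix c
      show "lookup (contract (\<lambda>m. Some (\<kappa> m)) p) c = lookup 0 c"
      proof (cases "c \<in> \<kappa> ` keys p")
        case False
        then show ?thesis
          by (auto simp: lookup_contract intro!: sum.neutral)
      next
        case True
        then obtain m0 where m0: "m0 \<in> keys p" "c = \<kappa> m0" by blast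
        let ?Z = "X ` S m0 \<union> Y ` S m0"
        have iff: "\<kappa> m = c \<longleftrightarrow> invariant ?V ?Z (comp_rep G (S m0)) m = Some c" if "m \<in> keys p" for m
        proof
          assume "\<kappa> m = c"
          moreover from this have "S m = S m0"
            unfolding m0 \<kappa>_def by (rule S_eq)
          moreover from this have "keys m \<inter> ?Z = {}"
            by (auto simp: S_def in_keys_iff)
          ultimately show "invariant ?V ?Z (comp_rep G (S m0)) m = Some c"
            by (simp add: invariant_def \<kappa>_def)
        next
          assume "invariant ?V ?Z (comp_rep G (S m0)) m = Some c"
          then have "weight ?V (comp_rep G (S m0)) m = c"
            by (simp add: invariant_def split: if_splits)
          moreover from this have "S m = S m0"
            unfolding m0 \<kappa>_def by (rule S_eq)
          ultimately show "\<kappa> m = c" by (simp add: \<kappa>_def)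
        qed
        have "S m0 \<subseteq> ?V" by (auto simp: S_def)
        from p[OF this] have "lookup (contract (invariant ?V ?Z (comp_rep G (S m0))) p) c = 0"
          by (simp add: component_prime_def toric_prime_def)
        also have "lookup (contract (invariant ?V ?Z (comp_rep G (S m0))) p) c =
            lookup (contract (\<lambda>m. Some (\<kappa> m)) p) c"
          unfolding lookup_contract by (intro sum.cong refl) (simp add: iff)
        finally show ?thesis by simp
      qed
    qed
  qed
qed

section \<open>Cut sets\<close>

text \<open>
  The condition says that each \<open>s \<in> S\<close> is a cut vertex of the graph induced on the complement of
  \<open>S - {s}\<close>, with the separated components witnessed by neighbours of \<open>s\<close>.
\<close>

definition cut_sets :: "'v pair_pre_digraph \<Rightarrow> 'v set set" where
  "cut_sets G = {S. S \<subseteq> pverts G \<and> (\<forall>s\<in>S. \<exists>i j. (s, i) \<in> parcs G \<and> (s, j) \<in> parcs G \<and>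
     i \<notin> S \<and> j \<notin> S \<and> (i, j) \<notin> (arcs_avoiding G S)\<^sup>*)}"

lemma empty_in_cut_sets: "{} \<in> cut_sets G"
  by (simp add: cut_sets_def)

lemma finite_cut_sets: "pair_graph G \<Longrightarrow> finite (cut_sets G)"
  using pair_graph_arcs(1)[of G] by (auto simp: cut_sets_def intro: finite_subset[of _ "Pow (pverts G)"])

text \<open>
  A path that enters and leaves \<open>s\<close> does so through two neighbours of \<open>s\<close>, and these are linked without
  \<open>s\<close>. The induction carries the statement for paths that end in \<open>s\<close>, too.
\<close>

lemma linked_delete_non_cut_vertex:
  assumes G: "pair_graph G"
    and nbrs: "\<And>i j. (s, i) \<in> parcs G \<Longrightarrow> (s, j) \<in> parcs G \<Longrightarrow> i \<notin> S \<Longrightarrow> j \<notin> S \<Longrightarrow>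
      (i, j) \<in> (arcs_avoiding G S)\<^sup>*"
    and path: "(k, l) \<in> (arcs_avoiding G (S - {s}))\<^sup>*" and k: "k \<noteq> s" and l: "l \<noteq> s"
  shows "(k, l) \<in> (arcs_avoiding G S)\<^sup>*"
proof -
  have "(y \<noteq> s \<longrightarrow> (k, y) \<in> (arcs_avoiding G S)\<^sup>*) \<and>
      (y = s \<longrightarrow> (\<exists>i. (s, i) \<in> parcs G \<and> i \<notin> S \<and> (k, i) \<in> (arcs_avoiding G S)\<^sup>*))"
    if "(k, y) \<in> (arcs_avoiding G (S - {s}))\<^sup>*" for y
    using that
  proof (induction rule: rtrancl_induct)
    case base
    with k show ?case by simp
  next
    case (step y z)
    have yz: "(y, z) \<in> parcs G" "y \<notin> S - {s}" "z \<notin> S - {s}" "(z, y) \<in> parcs G" "y \<noteq> z"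
      using step.hyps(2) pair_graph_arcs(2)[OF G, of y z] by (auto simp: arcs_avoiding_def)
    consider "y = s" "z \<noteq> s" | "y \<noteq> s" "z = s" | "y \<noteq> s" "z \<noteq> s" using yz(5) by blast
    then show ?case
    proof cases
      case 1
      with step.IH obtain i where i: "(s, i) \<in> parcs G" "i \<notin> S" "(k, i) \<in> (arcs_avoiding G S)\<^sup>*" by blast
      have "(i, z) \<in> (arcs_avoiding G S)\<^sup>*"
        using i yz 1 by (intro nbrs) auto
      with i(3) 1 show ?thesis by (auto intro: rtrancl_trans)
    next
      case 2
      with step.IH yz show ?thesis by auto
    next
      case 3
      with yz have "(y, z) \<in> arcs_avoiding G S" by (simp add: arcs_avoiding_def)
      with step.IH 3 show ?thesis by (auto intro: rtrancl_into_rtrancl)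
    qed
  qed
  with path l show ?thesis by blast
qed

lemma weight_restrict:
  assumes "finite V" "lookup m (X s) = 0"
  shows "weight (V - {s}) r m = weight V r m"
proof -
  have "(\<Sum>i | i \<in> V - {s} \<and> r i = c. lookup m (X i)) = (\<Sum>i | i \<in> V \<and> r i = c. lookup m (X i))" for c
    using assms by (intro sum.mono_neutral_left) auto
  then show ?thesis
    unfolding weight_def by (simp only:)
qed

text \<open>
  A monomial that survives for \<open>S\<close> has no slots on \<open>s\<close>. For such monomials the vertex \<open>s\<close> can be
  ignored in both invariants, and on the other vertices the two partitions into components agree.
\<close>

lemma component_prime_delete_non_cut_vertex:
  fixes G :: "'v::linorder pair_pre_digraph"
  assumes G: "pair_graph G" and s: "s \<in> S"
    and nbrs: "\<And>i j. (s, i) \<in> parcs G \<Longrightarrow> (s, j) \<in> parcs G \<Longrightarrow> i \<notin> S \<Longrightarrow> j \<notin> S \<Longrightarrow>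
      (i, j) \<in> (arcs_avoiding G S)\<^sup>*"
  shows "component_prime K G (S - {s}) \<subseteq> component_prime K G S"
  unfolding component_prime_def
proof (rule toric_prime_mono)
  let ?V = "pverts G"
  note V = pair_graph_arcs(1)[OF G]
  let ?Z = "\<lambda>S. X ` S \<union> Y ` S"
  fix m n :: "'v indet \<Rightarrow>\<^sub>0 nat"
  have Z: "?Z S = {X s, Y s} \<union> ?Z (S - {s})" using s by auto
  show "invariant ?V (?Z S) (comp_rep G S) m = None"
    if "invariant ?V (?Z (S - {s})) (comp_rep G (S - {s})) m = None"
    using that by (auto simp: invariant_def Z split: if_splits)
  assume eq: "invariant ?V (?Z (S - {s})) (comp_rep G (S - {s})) m =
      invariant ?V (?Z (S - {s})) (comp_rep G (S - {s})) n"
  show "invariant ?V (?Z S) (comp_rep G S) m = invariant ?V (?Z S) (comp_rep G S) n"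
  proof (cases "keys m \<inter> ?Z (S - {s}) = {}")
    case False
    with eq show ?thesis by (auto simp: invariant_def Z split: if_splits)
  next
    case True
    with eq have n: "keys n \<inter> ?Z (S - {s}) = {}"
      and w: "weight ?V (comp_rep G (S - {s})) m = weight ?V (comp_rep G (S - {s})) n"
      by (auto simp: invariant_def split: if_splits)
    from w have deg: "vertex_degree m s = vertex_degree n s"
      unfolding weight_eq_iff[OF V] by blast
    show ?thesis
    proof (cases "vertex_degree m s = 0")
      case False
      with deg have "keys m \<inter> ?Z S \<noteq> {}" "keys n \<inter> ?Z S \<noteq> {}"
        unfolding Z by (auto simp: in_keys_iff)
      then show ?thesis by (simp add: invariant_def)
    next
      case 0: True
      then have keys: "keys m \<inter> ?Z S = {}" "keys n \<inter> ?Z S = {}"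
        using True n deg unfolding Z by (auto simp: in_keys_iff)
      have restrict: "weight ?V r m = weight (?V - {s}) r m" "weight ?V r n = weight (?V - {s}) r n" for r
        using 0 deg by (simp_all add: weight_restrict[OF V])
      have "weight (?V - {s}) (comp_rep G S) m = weight (?V - {s}) (comp_rep G S) n"
      proof (rule weight_eq_coarsen[of _ "comp_rep G (S - {s})"])
        show "comp_rep G S k = comp_rep G S l"
          if "k \<in> ?V - {s}" "l \<in> ?V - {s}" "comp_rep G (S - {s}) k = comp_rep G (S - {s}) l" for k l
        proof -
          from that have "(k, l) \<in> (arcs_avoiding G (S - {s}))\<^sup>*" "k \<noteq> s" "l \<noteq> s"
            by (simp_all add: comp_rep_eq_iff[OF G])
          then have "(k, l) \<in> (arcs_avoiding G S)\<^sup>*"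
            using linked_delete_non_cut_vertex[OF G nbrs] by blast
          then show ?thesis by (simp add: comp_rep_eq_iff[OF G])
        qed
      qed (use V w in \<open>simp_all add: restrict\<close>)
      with keys show ?thesis by (simp add: invariant_def restrict)
    qed
  qed
qed

text \<open>
  Remove from \<open>S\<close>, one at a time, vertices that violate the condition on cut sets; the primes only get
  smaller.
\<close>

lemma ex_cut_set_component_prime_subset:
  fixes G :: "'v::linorder pair_pre_digraph"
  assumes G: "pair_graph G" and S: "S \<subseteq> pverts G"
  shows "\<exists>T\<in>cut_sets G. component_prime K G T \<subseteq> component_prime K G S"
proof -
  have "finite S" using S pair_graph_arcs(1)[OF G] by (rule finite_subset)
  then show ?thesis using S
  proof (induction S rule: finite_psubset_induct)
    case (psubset S)
    show ?case
    proof (cases "S \<in> cut_sets G")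
      case True
      then show ?thesis by blast
    next
      case False
      with psubset.prems obtain s where s: "s \<in> S"
        and nbrs: "\<And>i j. (s, i) \<in> parcs G \<Longrightarrow> (s, j) \<in> parcs G \<Longrightarrow> i \<notin> S \<Longrightarrow> j \<notin> S \<Longrightarrow>
          (i, j) \<in> (arcs_avoiding G S)\<^sup>*"
        unfolding cut_sets_def by blast
      have "S - {s} \<subset> S" "S - {s} \<subseteq> pverts G" using s psubset.prems by auto
      from psubset.IH[OF this] show ?thesis
        using component_prime_delete_non_cut_vertex[OF G s nbrs, of K] by blast
    qed
  qed
qed

lemma binomial_edge_ideal_eq_Inter:
  fixes G :: "'v::linorder pair_pre_digraph"
  assumes G: "pair_graph G"
  shows "binomial_edge_ideal K G = \<Inter> (component_prime K G ` cut_sets G)"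
proof
  show "binomial_edge_ideal K G \<subseteq> \<Inter> (component_prime K G ` cut_sets G)"
    using binomial_edge_ideal_subset_component_prime[OF G] by blast
  show "\<Inter> (component_prime K G ` cut_sets G) \<subseteq> binomial_edge_ideal K G"
  proof
    fix p assume p: "p \<in> \<Inter> (component_prime K G ` cut_sets G)"
    show "p \<in> binomial_edge_ideal K G"
    proof (rule in_binomial_edge_ideal_if_in_component_primes[OF G])
      fix S assume "S \<subseteq> pverts G"
      from ex_cut_set_component_prime_subset[OF G this, of K] p
      show "p \<in> component_prime K G S" by blast
    qed
  qed
qed

text \<open>
  The variables in a component prime determine its vertex set, which gives \<open>T \<subseteq> S\<close>. If \<open>s \<in> S - T\<close>, the
  binomial of two neighbours of \<open>s\<close> that are separated by \<open>S\<close> distinguishes the primes, since these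
  neighbours are joined through \<open>s\<close> when only \<open>T\<close> is deleted.
\<close>

lemma component_prime_antichain:
  fixes G :: "'v::linorder pair_pre_digraph" and K :: "'k::field itself"
  assumes G: "pair_graph G" and S: "S \<in> cut_sets G" and T: "T \<in> cut_sets G"
    and sub: "component_prime K G T \<subseteq> component_prime K G S"
  shows "T = S"
proof
  note V = pair_graph_arcs(1)[OF G]
  show T_sub: "T \<subseteq> S"
  proof
    fix t assume t: "t \<in> T"
    then have "X t \<in> X ` pverts G \<union> Y ` pverts G" using T by (auto simp: cut_sets_def)
    note var_iff = var_in_toric_prime_iff[OF this, of K]
    have "var K (X t) \<in> component_prime K G T"
      unfolding component_prime_def var_iff using t by blast
    with sub have "var K (X t) \<in> component_prime K G S" by blast
    then show "t \<in> S"
      unfolding component_prime_def var_iff by auto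
  qed
  show "S \<subseteq> T"
  proof (rule ccontr)
    assume "\<not> S \<subseteq> T"
    then obtain s where s: "s \<in> S" "s \<notin> T" by blast
    with S obtain i j where ij: "(s, i) \<in> parcs G" "(s, j) \<in> parcs G" "i \<notin> S" "j \<notin> S"
      "(i, j) \<notin> (arcs_avoiding G S)\<^sup>*"
      unfolding cut_sets_def by blast
    have in_V: "i \<in> pverts G" "j \<in> pverts G" "(i, s) \<in> parcs G"
      using ij pair_graph_arcs(2)[OF G] by blast+
    have "(i, s) \<in> arcs_avoiding G T" "(s, j) \<in> arcs_avoiding G T"
      using ij in_V s T_sub by (auto simp: arcs_avoiding_def)
    then have "(i, j) \<in> (arcs_avoiding G T)\<^sup>*" by auto
    then have "edge_binomial K i j \<in> component_prime K G T"
      unfolding component_prime_def using V in_V ij T_sub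
      by (subst edge_binomial_in_toric_prime_iff) (auto simp: comp_rep_eq_iff[OF G])
    moreover have "edge_binomial K i j \<notin> component_prime K G S"
      unfolding component_prime_def using V in_V ij
      by (subst edge_binomial_in_toric_prime_iff) (auto simp: comp_rep_eq_iff[OF G])
    ultimately show False using sub by blast
  qed
qed

section \<open>Associated primes\<close>

text \<open>
  Multiply elements chosen from each of the ideals outside \<open>P\<close>.
\<close>

lemma prime_avoiding_product:
  fixes R (structure)
  assumes P: "primeideal P R" and fin: "finite \<Q>"
    and Q: "\<And>Q. Q \<in> \<Q> \<Longrightarrow> ideal Q R \<and> \<not> Q \<subseteq> P"
  shows "\<exists>f\<in>carrier R. f \<notin> P \<and> (\<forall>Q\<in>\<Q>. f \<in> Q)"
  using fin Q
proof (induction \<Q> rule: finite_induct)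
  case empty
  interpret primeideal P R by fact
  from I_notcarr a_subset show ?case by blast
next
  case (insert Q \<Q>)
  interpret primeideal P R by fact
  from insert obtain f where f: "f \<in> carrier R" "f \<notin> P" "\<forall>Q\<in>\<Q>. f \<in> Q" by auto
  from insert.prems[of Q] obtain g where g: "g \<in> Q" "g \<notin> P" by blast
  have "ideal Q R" using insert.prems[of Q] by simp
  then have g_carrier: "g \<in> carrier R"
    using g(1) by (rule ideal.Icarr)
  have "f \<otimes> g \<notin> P" using I_prime[OF f(1) g_carrier] f(2) g(2) by blast
  moreover have "f \<otimes> g \<in> Q'" if Q': "Q' \<in> insert Q \<Q>" for Q'
  proof -
    interpret Q': ideal Q' R using insert.prems[OF Q'] by simp
    show ?thesis
    proof (cases "Q' = Q")
      case True
      with g(1) f(1) show ?thesis by (intro Q'.I_l_closed) simp_all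
    next
      case False
      with Q' f(3) g_carrier show ?thesis by (intro Q'.I_r_closed) simp_all
    qed
  qed
  ultimately show ?case using f(1) g_carrier by blast
qed

text \<open>
  By prime avoidance there is an \<open>f\<close> outside a given member \<open>P\<close> and inside all others, and then the
  colon ideal of \<open>f\<close> is \<open>P\<close>. Conversely, a colon ideal of \<open>f\<close> is the intersection of the members that do
  not contain \<open>f\<close>; if it is prime, it contains one of them and hence equals it.
\<close>

lemma associated_primes_Inter:
  fixes R (structure)
  assumes fin: "finite \<P>" and ne: "\<P> \<noteq> {}" and prime: "\<And>P. P \<in> \<P> \<Longrightarrow> primeideal P R"
    and antichain: "\<And>P Q. P \<in> \<P> \<Longrightarrow> Q \<in> \<P> \<Longrightarrow> P \<subseteq> Q \<Longrightarrow> P = Q"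
  shows "associated_primes R (\<Inter>\<P>) = \<P>"
proof
  show "\<P> \<subseteq> associated_primes R (\<Inter>\<P>)"
  proof
    fix P assume P: "P \<in> \<P>"
    interpret primeideal P R using P by (rule prime)
    have "\<exists>f\<in>carrier R. f \<notin> P \<and> (\<forall>Q\<in>\<P> - {P}. f \<in> Q)"
    proof (rule prime_avoiding_product[OF primeideal])
      show "finite (\<P> - {P})" using fin by simp
      show "ideal Q R \<and> \<not> Q \<subseteq> P" if "Q \<in> \<P> - {P}" for Q
      proof
        show "ideal Q R" using that by (intro primeideal.axioms(1) prime) simp
        show "\<not> Q \<subseteq> P" using that P antichain[of Q P] by auto
      qed
    qed
    then obtain f where f: "f \<in> carrier R" "f \<notin> P" "\<And>Q. Q \<in> \<P> \<Longrightarrow> Q \<noteq> P \<Longrightarrow> f \<in> Q" by blast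
    have colon: "P = {a \<in> carrier R. a \<otimes> f \<in> \<Inter>\<P>}"
    proof (intro equalityI subsetI)
      fix a assume a: "a \<in> P"
      then have "a \<in> carrier R" by (rule Icarr)
      moreover have "a \<otimes> f \<in> Q" if "Q \<in> \<P>" for Q
      proof (cases "Q = P")
        case True
        with I_r_closed[OF a f(1)] show ?thesis by simp
      next
        case False
        show ?thesis
          by (rule ideal.I_l_closed[OF primeideal.axioms(1)[OF prime[OF that]] f(3)[OF that False]]) fact
      qed
      ultimately show "a \<in> {a \<in> carrier R. a \<otimes> f \<in> \<Inter>\<P>}" by blast
    next
      fix a assume "a \<in> {a \<in> carrier R. a \<otimes> f \<in> \<Inter>\<P>}"
      then have "a \<in> carrier R" "a \<otimes> f \<in> P" using P by simp_all
      then show "a \<in> P" using I_prime[of a f] f(1,2) by simp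
    qed
    show "P \<in> associated_primes R (\<Inter>\<P>)"
      unfolding associated_primes_def
      by (intro CollectI conjI primeideal bexI[of _ f] colon f(1))
  qed
  show "associated_primes R (\<Inter>\<P>) \<subseteq> \<P>"
  proof
    fix P assume "P \<in> associated_primes R (\<Inter>\<P>)"
    then have "primeideal P R" "\<exists>f\<in>carrier R. P = {a \<in> carrier R. a \<otimes> f \<in> \<Inter>\<P>}"
      by (simp_all add: associated_primes_def)
    moreover from this(2) obtain f where "f \<in> carrier R" "P = {a \<in> carrier R. a \<otimes> f \<in> \<Inter>\<P>}"
      by (rule bexE)
    ultimately have P: "primeideal P R" "f \<in> carrier R" "P = {a \<in> carrier R. a \<otimes> f \<in> \<Inter>\<P>}"
      by simp_all
    interpret primeideal P R by fact
    have sub: "P \<subseteq> Q" if "Q \<in> \<P>" "f \<notin> Q" for Q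
    proof
      fix a assume "a \<in> P"
      then have "a \<in> carrier R" "a \<otimes> f \<in> Q" unfolding P(3) using that(1) by simp_all
      then show "a \<in> Q"
        using primeideal.I_prime[OF prime[OF that(1)], of a f] P(2) that(2) by simp
    qed
    have "\<exists>Q\<in>\<P>. f \<notin> Q \<and> Q \<subseteq> P"
    proof (rule ccontr)
      assume neg: "\<not> ?thesis"
      have "\<exists>g\<in>carrier R. g \<notin> P \<and> (\<forall>Q\<in>{Q \<in> \<P>. f \<notin> Q}. g \<in> Q)"
      proof (rule prime_avoiding_product[OF P(1)])
        show "finite {Q \<in> \<P>. f \<notin> Q}" using fin by simp
        show "ideal Q R \<and> \<not> Q \<subseteq> P" if "Q \<in> {Q \<in> \<P>. f \<notin> Q}" for Q
        proof
          show "ideal Q R" using that by (intro primeideal.axioms(1) prime) simp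
          show "\<not> Q \<subseteq> P" using that neg by blast
        qed
      qed
      then obtain g where g: "g \<in> carrier R" "g \<notin> P" "\<And>Q. Q \<in> \<P> \<Longrightarrow> f \<notin> Q \<Longrightarrow> g \<in> Q" by blast
      have "g \<otimes> f \<in> Q" if Q: "Q \<in> \<P>" for Q
      proof -
        interpret Q: ideal Q R using prime[OF Q] by (rule primeideal.axioms(1))
        show ?thesis
          using Q.I_l_closed[of f g] Q.I_r_closed[of g f] g(1) g(3)[OF Q] P(2) by (cases "f \<in> Q") simp_all
      qed
      with g(1) have "g \<in> P" unfolding P(3) by blast
      with g(2) show False ..
    qed
    then obtain Q where Q: "Q \<in> \<P>" "f \<notin> Q" "Q \<subseteq> P" by blast
    have "P = Q" using sub[OF Q(1,2)] Q(3) by (rule subset_antisym)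
    with Q(1) show "P \<in> \<P>" by simp
  qed
qed

theorem associated_primes_binomial_edge_ideal:
  fixes G :: "'v::linorder pair_pre_digraph"
  assumes G: "pair_graph G"
  shows "associated_primes (poly_ring K (pverts G)) (binomial_edge_ideal K G) =
    component_prime K G ` cut_sets G"
  unfolding binomial_edge_ideal_eq_Inter[OF G]
proof (rule associated_primes_Inter)
  show "finite (component_prime K G ` cut_sets G)"
    using finite_cut_sets[OF G] by simp
  show "component_prime K G ` cut_sets G \<noteq> {}"
    using empty_in_cut_sets by blast
qed (use primeideal_component_prime[OF G] component_prime_antichain[OF G] in \<open>blast+\<close>)

text \<open>
  All heights have to agree with the height of the prime of the empty cut set.
\<close>

theorem unmixed_binomial_edge_ideal_iff:
  fixes G :: "'v::linorder pair_pre_digraph"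
  assumes G: "pair_graph G"
  shows "unmixed (poly_ring K (pverts G)) (binomial_edge_ideal K G) \<longleftrightarrow>
    (\<forall>S\<in>cut_sets G. card (components G S) = card S + card (components G {}))"
proof -
  let ?ht = "\<lambda>S. prime_height (poly_ring K (pverts G)) (component_prime K G S)"
  have same: "?ht S = ?ht {} \<longleftrightarrow> card (components G S) = card S + card (components G {})"
    if "S \<in> cut_sets G" for S
  proof -
    have "S \<subseteq> pverts G" using that by (simp add: cut_sets_def)
    from prime_height_component_prime[OF G this, of K] prime_height_component_prime[OF G, of "{}" K]
    obtain h h0 where "?ht S = enat h" "h + card (components G S) = card (pverts G) + card S"
      "?ht {} = enat h0" "h0 + card (components G {}) = card (pverts G)"
      by auto
    then show ?thesis by auto
  qed
  have "unmixed (poly_ring K (pverts G)) (binomial_edge_ideal K G) \<longleftrightarrow>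
      (\<forall>S\<in>cut_sets G. \<forall>T\<in>cut_sets G. ?ht S = ?ht T)"
    by (simp add: unmixed_def associated_primes_binomial_edge_ideal[OF G])
  also have "\<dots> \<longleftrightarrow> (\<forall>S\<in>cut_sets G. ?ht S = ?ht {})"
    using empty_in_cut_sets[of G] by metis
  also have "\<dots> \<longleftrightarrow> (\<forall>S\<in>cut_sets G. card (components G S) = card S + card (components G {}))"
    using same by simp
  finally show ?thesis .
qed

section \<open>The cone over two disjoint connected graphs\<close>

lemma rtrancl_Un_disjoint:
  assumes "A \<subseteq> V \<times> V" "B \<subseteq> W \<times> W" "V \<inter> W = {}" "i \<in> V"
  shows "(i, j) \<in> (A \<union> B)\<^sup>* \<longleftrightarrow> (i, j) \<in> A\<^sup>*"
proof
  assume "(i, j) \<in> (A \<union> B)\<^sup>*"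
  then have "(i, j) \<in> A\<^sup>* \<and> j \<in> V"
    by (induction rule: rtrancl_induct) (use assms in \<open>auto intro: rtrancl_into_rtrancl\<close>)
  then show "(i, j) \<in> A\<^sup>*" ..
next
  assume "(i, j) \<in> A\<^sup>*"
  then show "(i, j) \<in> (A \<union> B)\<^sup>*"
    by (rule subsetD[OF rtrancl_mono, rotated]) blast
qed

lemma connected_linked:
  assumes G: "pair_graph G" and "connected (with_proj G)" "i \<in> pverts G" "j \<in> pverts G"
  shows "(i, j) \<in> (arcs_avoiding G {})\<^sup>*"
proof -
  let ?M = "mk_symmetric (with_proj G)"
  from assms have "i \<rightarrow>\<^sup>*\<^bsub>with_proj ?M\<^esub> j"
    by (auto simp: connected_def strongly_connected_def)
  then have "(i, j) \<in> (parcs ?M)\<^sup>*"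
    by (auto dest!: reachable_rtranclI)
  moreover have "parcs ?M \<subseteq> arcs_avoiding G {}"
    using pair_graph_arcs(2)[OF G] by (auto simp: mk_symmetric_def arcs_avoiding_def)
  ultimately show ?thesis
    using rtrancl_mono by blast
qed

lemma card_components_connected:
  assumes G: "pair_graph G" and "connected (with_proj G)"
  shows "pverts G \<noteq> {}" "card (components G {}) = 1"
proof -
  show ne: "pverts G \<noteq> {}"
    using assms(2) by (simp add: connected_def strongly_connected_def)
  then obtain i where i: "i \<in> pverts G" by blast
  have "component G {} k = component G {} i" if "k \<in> pverts G" for k
    unfolding component_eq_iff[OF G] using that i by (rule connected_linked[OF assms])
  then have "components G {} = (\<lambda>_. component G {} i) ` pverts G"
    unfolding components_def Diff_empty by (rule image_cong[OF refl])
  also have "\<dots> = {component G {} i}" using i by auto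
  finally show "card (components G {}) = 1" by simp
qed

lemma cut_set_complement_nonempty:
  assumes G: "pair_graph G" and "pverts G \<noteq> {}" "T \<in> cut_sets G"
  shows "pverts G - T \<noteq> {}"
proof (cases "T = {}")
  case True
  with assms show ?thesis by simp
next
  case False
  with assms(3) obtain s i where "(s, i) \<in> parcs G" "i \<notin> T" unfolding cut_sets_def by blast
  with pair_graph_arcs(2)[OF G] show ?thesis by blast
qed

context
  fixes H\<^sub>1 H\<^sub>2 G :: "'v pair_pre_digraph" and v :: 'v
  assumes H1: "pair_graph H\<^sub>1" and H2: "pair_graph H\<^sub>2"
    and disj: "pverts H\<^sub>1 \<inter> pverts H\<^sub>2 = {}"
    and v: "v \<notin> pverts H\<^sub>1 \<union> pverts H\<^sub>2"
    and G: "G = cone v (graph_union H\<^sub>1 H\<^sub>2)"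
begin

lemma pair_graph_cone_union: "pair_graph G"
  unfolding G using H1 H2 v by (intro pair_graph_cone pair_graph_graph_union) (auto simp: graph_union_def)

lemma pverts_cone_union: "pverts G = insert v (pverts H\<^sub>1 \<union> pverts H\<^sub>2)"
  by (simp add: G cone_def graph_union_def)

lemma parcs_subset: "parcs H\<^sub>1 \<subseteq> pverts H\<^sub>1 \<times> pverts H\<^sub>1" "parcs H\<^sub>2 \<subseteq> pverts H\<^sub>2 \<times> pverts H\<^sub>2"
  using H1 H2 by (simp_all add: pair_graph_iff)

lemma parcs_cone_union:
  "(i, j) \<in> parcs G \<longleftrightarrow> (i, j) \<in> parcs H\<^sub>1 \<or> (i, j) \<in> parcs H\<^sub>2 \<or>
    i \<in> pverts H\<^sub>1 \<union> pverts H\<^sub>2 \<and> j = v \<or> i = v \<and> j \<in> pverts H\<^sub>1 \<union> pverts H\<^sub>2"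
  by (auto simp: G cone_def graph_union_def)

text \<open>
  The apex is adjacent to all other vertices, so nothing is separated while it is present.
\<close>

lemma linked_cone_union_apex:
  assumes "v \<notin> S" "i \<in> pverts G - S" "j \<in> pverts G - S"
  shows "(i, j) \<in> (arcs_avoiding G S)\<^sup>*"
proof -
  have "(i, v) \<in> (arcs_avoiding G S)\<^sup>*" if "i \<in> pverts G - S" for i
    using that assms(1) by (cases "i = v") (auto simp: arcs_avoiding_def parcs_cone_union pverts_cone_union)
  then show ?thesis
    using assms linked_sym[OF pair_graph_cone_union] by (meson rtrancl_trans)
qed

lemma linked_cone_union_iff:
  assumes "v \<in> S"
  shows "i \<in> pverts H\<^sub>1 \<Longrightarrow>
      (i, j) \<in> (arcs_avoiding G S)\<^sup>* \<longleftrightarrow> (i, j) \<in> (arcs_avoiding H\<^sub>1 (S \<inter> pverts H\<^sub>1))\<^sup>*"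
    and "i \<in> pverts H\<^sub>2 \<Longrightarrow>
      (i, j) \<in> (arcs_avoiding G S)\<^sup>* \<longleftrightarrow> (i, j) \<in> (arcs_avoiding H\<^sub>2 (S \<inter> pverts H\<^sub>2))\<^sup>*"
proof -
  let ?A = "\<lambda>H. arcs_avoiding H (S \<inter> pverts H)"
  have A: "arcs_avoiding G S = ?A H\<^sub>1 \<union> ?A H\<^sub>2"
    using assms parcs_subset by (auto simp: arcs_avoiding_def parcs_cone_union)
  have sub: "?A H\<^sub>1 \<subseteq> pverts H\<^sub>1 \<times> pverts H\<^sub>1" "?A H\<^sub>2 \<subseteq> pverts H\<^sub>2 \<times> pverts H\<^sub>2"
    using parcs_subset by (auto simp: arcs_avoiding_def)
  show "i \<in> pverts H\<^sub>1 \<Longrightarrow> (i, j) \<in> (arcs_avoiding G S)\<^sup>* \<longleftrightarrow> (i, j) \<in> (?A H\<^sub>1)\<^sup>*"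
    unfolding A by (rule rtrancl_Un_disjoint[OF sub disj])
  show "i \<in> pverts H\<^sub>2 \<Longrightarrow> (i, j) \<in> (arcs_avoiding G S)\<^sup>* \<longleftrightarrow> (i, j) \<in> (?A H\<^sub>2)\<^sup>*"
    unfolding A Un_commute[of "?A H\<^sub>1"]
    by (rule rtrancl_Un_disjoint[OF sub(2,1)]) (use disj in auto)
qed

lemma card_components_cone_union:
  assumes "T\<^sub>1 \<subseteq> pverts H\<^sub>1" "T\<^sub>2 \<subseteq> pverts H\<^sub>2"
  shows "card (components G (insert v (T\<^sub>1 \<union> T\<^sub>2))) = card (components H\<^sub>1 T\<^sub>1) + card (components H\<^sub>2 T\<^sub>2)"
proof -
  let ?S = "insert v (T\<^sub>1 \<union> T\<^sub>2)"
  have S: "?S \<inter> pverts H\<^sub>1 = T\<^sub>1" "?S \<inter> pverts H\<^sub>2 = T\<^sub>2" "v \<in> ?S"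
    using assms disj v by auto
  have "component G ?S i = component H\<^sub>1 T\<^sub>1 i" if "i \<in> pverts H\<^sub>1" for i
    using linked_cone_union_iff(1)[OF S(3) that] S(1) by (simp add: component_def)
  moreover have "component G ?S i = component H\<^sub>2 T\<^sub>2 i" if "i \<in> pverts H\<^sub>2" for i
    using linked_cone_union_iff(2)[OF S(3) that] S(2) by (simp add: component_def)
  moreover have "pverts G - ?S = (pverts H\<^sub>1 - T\<^sub>1) \<union> (pverts H\<^sub>2 - T\<^sub>2)"
    using assms disj v by (auto simp: pverts_cone_union)
  ultimately have "components G ?S = components H\<^sub>1 T\<^sub>1 \<union> components H\<^sub>2 T\<^sub>2"
    by (simp add: components_def image_Un)
  moreover have "components H\<^sub>1 T\<^sub>1 \<inter> components H\<^sub>2 T\<^sub>2 = {}"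
  proof -
    have in_H: "i \<in> component H T i" "component H T i \<subseteq> pverts H"
      if "pair_graph H" "i \<in> pverts H" for H :: "'v pair_pre_digraph" and T i
      using linked_in_pverts(1)[OF that(1) _ that(2)] by (auto simp: component_def)
    show ?thesis
      using in_H[OF H1] in_H[OF H2] disj by (auto simp: components_def) blast
  qed
  moreover have "finite (components H\<^sub>1 T\<^sub>1)" "finite (components H\<^sub>2 T\<^sub>2)"
    using pair_graph_arcs(1)[OF H1] pair_graph_arcs(1)[OF H2] by (simp_all add: components_def)
  ultimately show ?thesis by (simp add: card_Un_disjoint)
qed

text \<open>
  A cut set without the apex leaves a connected graph and is therefore empty. Once the apex is deleted,
  the neighbours of a vertex of \<open>H\<^sub>i\<close> and their links lie in \<open>H\<^sub>i\<close>. The apex itself always satisfies the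
  condition: neither cut set exhausts its graph, so the apex has a neighbour left on either side.
\<close>

lemma cut_sets_cone_union:
  assumes ne: "pverts H\<^sub>1 \<noteq> {}" "pverts H\<^sub>2 \<noteq> {}"
  shows "cut_sets G = insert {} {insert v (T\<^sub>1 \<union> T\<^sub>2) | T\<^sub>1 T\<^sub>2. T\<^sub>1 \<in> cut_sets H\<^sub>1 \<and> T\<^sub>2 \<in> cut_sets H\<^sub>2}"
proof (intro equalityI subsetI)
  fix S assume S: "S \<in> cut_sets G"
  show "S \<in> insert {} {insert v (T\<^sub>1 \<union> T\<^sub>2) | T\<^sub>1 T\<^sub>2. T\<^sub>1 \<in> cut_sets H\<^sub>1 \<and> T\<^sub>2 \<in> cut_sets H\<^sub>2}"
  proof (cases "v \<in> S")
    case False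
    have "S = {}"
    proof (rule ccontr)
      assume "S \<noteq> {}"
      with S obtain s i j where "(s, i) \<in> parcs G" "(s, j) \<in> parcs G" "i \<notin> S" "j \<notin> S"
        "(i, j) \<notin> (arcs_avoiding G S)\<^sup>*"
        unfolding cut_sets_def by blast
      moreover from this have "i \<in> pverts G" "j \<in> pverts G"
        using pair_graph_arcs(2)[OF pair_graph_cone_union] by blast+
      ultimately show False using linked_cone_union_apex[OF False, of i j] by blast
    qed
    then show ?thesis by simp
  next
    case True
    have "S \<inter> pverts H\<^sub>1 \<in> cut_sets H\<^sub>1"
      unfolding cut_sets_def
    proof (intro CollectI conjI ballI)
      fix s assume s: "s \<in> S \<inter> pverts H\<^sub>1"
      with S obtain i j where ij: "(s, i) \<in> parcs G" "(s, j) \<in> parcs G" "i \<notin> S" "j \<notin> S"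
        "(i, j) \<notin> (arcs_avoiding G S)\<^sup>*"
        unfolding cut_sets_def by blast
      have "(s, i) \<in> parcs H\<^sub>1" "(s, j) \<in> parcs H\<^sub>1"
        using ij(1-4) s True disj v parcs_subset(2) by (auto simp: parcs_cone_union)
      moreover from this have "i \<in> pverts H\<^sub>1" using parcs_subset(1) by blast
      ultimately show "\<exists>i j. (s, i) \<in> parcs H\<^sub>1 \<and> (s, j) \<in> parcs H\<^sub>1 \<and> i \<notin> S \<inter> pverts H\<^sub>1 \<and>
          j \<notin> S \<inter> pverts H\<^sub>1 \<and> (i, j) \<notin> (arcs_avoiding H\<^sub>1 (S \<inter> pverts H\<^sub>1))\<^sup>*"
        using ij linked_cone_union_iff(1)[OF True] by blast
    qed simp
    moreover have "S \<inter> pverts H\<^sub>2 \<in> cut_sets H\<^sub>2"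
      unfolding cut_sets_def
    proof (intro CollectI conjI ballI)
      fix s assume s: "s \<in> S \<inter> pverts H\<^sub>2"
      with S obtain i j where ij: "(s, i) \<in> parcs G" "(s, j) \<in> parcs G" "i \<notin> S" "j \<notin> S"
        "(i, j) \<notin> (arcs_avoiding G S)\<^sup>*"
        unfolding cut_sets_def by blast
      have "(s, i) \<in> parcs H\<^sub>2" "(s, j) \<in> parcs H\<^sub>2"
        using ij(1-4) s True disj v parcs_subset(1) by (auto simp: parcs_cone_union)
      moreover from this have "i \<in> pverts H\<^sub>2" using parcs_subset(2) by blast
      ultimately show "\<exists>i j. (s, i) \<in> parcs H\<^sub>2 \<and> (s, j) \<in> parcs H\<^sub>2 \<and> i \<notin> S \<inter> pverts H\<^sub>2 \<and>
          j \<notin> S \<inter> pverts H\<^sub>2 \<and> (i, j) \<notin> (arcs_avoiding H\<^sub>2 (S \<inter> pverts H\<^sub>2))\<^sup>*"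
        using ij linked_cone_union_iff(2)[OF True] by blast
    qed simp
    moreover have "S = insert v (S \<inter> pverts H\<^sub>1 \<union> S \<inter> pverts H\<^sub>2)"
      using S True by (auto simp: cut_sets_def pverts_cone_union)
    ultimately show ?thesis by blast
  qed
next
  fix S assume "S \<in> insert {} {insert v (T\<^sub>1 \<union> T\<^sub>2) | T\<^sub>1 T\<^sub>2. T\<^sub>1 \<in> cut_sets H\<^sub>1 \<and> T\<^sub>2 \<in> cut_sets H\<^sub>2}"
  then consider "S = {}" | T\<^sub>1 T\<^sub>2 where "S = insert v (T\<^sub>1 \<union> T\<^sub>2)" "T\<^sub>1 \<in> cut_sets H\<^sub>1" "T\<^sub>2 \<in> cut_sets H\<^sub>2"
    by blast
  then show "S \<in> cut_sets G"
  proof cases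
    case 1
    then show ?thesis by (simp add: empty_in_cut_sets)
  next
    case 2
    then have T: "T\<^sub>1 \<subseteq> pverts H\<^sub>1" "T\<^sub>2 \<subseteq> pverts H\<^sub>2" by (auto simp: cut_sets_def)
    have S: "S \<inter> pverts H\<^sub>1 = T\<^sub>1" "S \<inter> pverts H\<^sub>2 = T\<^sub>2" "v \<in> S"
      using 2(1) T disj v by auto
    show ?thesis
      unfolding cut_sets_def
    proof (intro CollectI conjI ballI)
      show "S \<subseteq> pverts G" using 2(1) T by (auto simp: pverts_cone_union)
      fix s assume "s \<in> S"
      then consider "s = v" | "s \<in> T\<^sub>1" | "s \<in> T\<^sub>2" using 2(1) by blast
      then show "\<exists>i j. (s, i) \<in> parcs G \<and> (s, j) \<in> parcs G \<and> i \<notin> S \<and> j \<notin> S \<and>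
          (i, j) \<notin> (arcs_avoiding G S)\<^sup>*"
      proof cases
        case 1
        obtain i j where ij: "i \<in> pverts H\<^sub>1 - T\<^sub>1" "j \<in> pverts H\<^sub>2 - T\<^sub>2"
          using cut_set_complement_nonempty[OF H1 ne(1) 2(2)] cut_set_complement_nonempty[OF H2 ne(2) 2(3)]
          by blast
        have "(i, j) \<notin> (arcs_avoiding G S)\<^sup>*"
          using linked_cone_union_iff(1)[OF S(3), of i j] linked_in_pverts(1)[OF H1, of i j] ij disj by blast
        then show ?thesis
          using 1 ij S by (intro exI[of _ i] exI[of _ j]) (auto simp: parcs_cone_union)
      next
        case 2: 2
        then obtain i j where ij: "(s, i) \<in> parcs H\<^sub>1" "(s, j) \<in> parcs H\<^sub>1" "i \<notin> T\<^sub>1" "j \<notin> T\<^sub>1"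
          "(i, j) \<notin> (arcs_avoiding H\<^sub>1 T\<^sub>1)\<^sup>*"
          using \<open>T\<^sub>1 \<in> cut_sets H\<^sub>1\<close> unfolding cut_sets_def by blast
        then have "i \<in> pverts H\<^sub>1" "j \<in> pverts H\<^sub>1" using parcs_subset(1) by blast+
        then show ?thesis
          using ij S linked_cone_union_iff(1)[OF S(3), of i j]
          by (intro exI[of _ i] exI[of _ j]) (auto simp: parcs_cone_union)
      next
        case 3
        then obtain i j where ij: "(s, i) \<in> parcs H\<^sub>2" "(s, j) \<in> parcs H\<^sub>2" "i \<notin> T\<^sub>2" "j \<notin> T\<^sub>2"
          "(i, j) \<notin> (arcs_avoiding H\<^sub>2 T\<^sub>2)\<^sup>*"
          using \<open>T\<^sub>2 \<in> cut_sets H\<^sub>2\<close> unfolding cut_sets_def by blast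
        then have "i \<in> pverts H\<^sub>2" "j \<in> pverts H\<^sub>2" using parcs_subset(2) by blast+
        then show ?thesis
          using ij S linked_cone_union_iff(2)[OF S(3), of i j]
          by (intro exI[of _ i] exI[of _ j]) (auto simp: parcs_cone_union)
      qed
    qed
  qed
qed

lemma card_components_cone_union_empty: "card (components G {}) = 1"
proof -
  have "component G {} k = component G {} v" if "k \<in> pverts G" for k
    unfolding component_eq_iff[OF pair_graph_cone_union] using that by (intro linked_cone_union_apex) (auto simp: pverts_cone_union)
  then have "components G {} = (\<lambda>_. component G {} v) ` pverts G"
    unfolding components_def Diff_empty by (rule image_cong[OF refl])
  also have "\<dots> = {component G {} v}" by (auto simp: pverts_cone_union)
  finally show ?thesis by simp
qed

end

theorem corollary3p7:
  fixes K :: "'k::field itself"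
    and H\<^sub>1 H\<^sub>2 H G :: "'v::linorder pair_pre_digraph"
    and v :: 'v
  assumes "pair_graph H\<^sub>1" and "pair_graph H\<^sub>2"
    and "connected (with_proj H\<^sub>1)" and "connected (with_proj H\<^sub>2)"
    and "pverts H\<^sub>1 \<inter> pverts H\<^sub>2 = {}"
    and "H = graph_union H\<^sub>1 H\<^sub>2"
    and "v \<notin> pverts H"
    and "G = cone v H"
  shows "unmixed (poly_ring K (pverts H\<^sub>1)) (binomial_edge_ideal K H\<^sub>1)
           \<and> unmixed (poly_ring K (pverts H\<^sub>2)) (binomial_edge_ideal K H\<^sub>2)
         \<longleftrightarrow> unmixed (poly_ring K (pverts G)) (binomial_edge_ideal K G)"
proof -
  have v: "v \<notin> pverts H\<^sub>1 \<union> pverts H\<^sub>2"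
    using assms(6,7) by (simp add: graph_union_def)
  have "G = cone v (graph_union H\<^sub>1 H\<^sub>2)"
    using assms(6,8) by simp
  note setting = assms(1,2,5) v this
  have G: "pair_graph G"
    by (rule pair_graph_cone_union[OF setting])
  note H1 = card_components_connected[OF assms(1,3)] and H2 = card_components_connected[OF assms(2,4)]
  have count: "card (components G (insert v (T\<^sub>1 \<union> T\<^sub>2))) = card (insert v (T\<^sub>1 \<union> T\<^sub>2)) + 1 \<longleftrightarrow>
      card (components H\<^sub>1 T\<^sub>1) + card (components H\<^sub>2 T\<^sub>2) = (card T\<^sub>1 + 1) + (card T\<^sub>2 + 1)"
    if "T\<^sub>1 \<in> cut_sets H\<^sub>1" "T\<^sub>2 \<in> cut_sets H\<^sub>2" for T\<^sub>1 T\<^sub>2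
  proof -
    have T: "T\<^sub>1 \<subseteq> pverts H\<^sub>1" "T\<^sub>2 \<subseteq> pverts H\<^sub>2" using that by (auto simp: cut_sets_def)
    then have fin: "finite T\<^sub>1" "finite T\<^sub>2"
      using pair_graph_arcs(1)[OF assms(1)] pair_graph_arcs(1)[OF assms(2)] by (auto intro: finite_subset)
    have "v \<notin> T\<^sub>1 \<union> T\<^sub>2" "T\<^sub>1 \<inter> T\<^sub>2 = {}" using T v assms(5) by auto
    with fin have "card (insert v (T\<^sub>1 \<union> T\<^sub>2)) = Suc (card T\<^sub>1 + card T\<^sub>2)"
      by (simp add: card_Un_disjoint)
    then show ?thesis
      by (auto simp: card_components_cone_union[OF setting T])
  qed
  have "unmixed (poly_ring K (pverts G)) (binomial_edge_ideal K G) \<longleftrightarrow>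
      (\<forall>S\<in>cut_sets G. card (components G S) = card S + 1)"
    unfolding unmixed_binomial_edge_ideal_iff[OF G]
    by (simp add: card_components_cone_union_empty[OF setting])
  also have "\<dots> \<longleftrightarrow> (\<forall>T\<^sub>1\<in>cut_sets H\<^sub>1. \<forall>T\<^sub>2\<in>cut_sets H\<^sub>2.
      card (components H\<^sub>1 T\<^sub>1) + card (components H\<^sub>2 T\<^sub>2) = (card T\<^sub>1 + 1) + (card T\<^sub>2 + 1))"
    (is "?L \<longleftrightarrow> ?R")
  proof -
    note cut = cut_sets_cone_union[OF setting H1(1) H2(1)]
    show ?thesis
    proof
      assume L: ?L
      show ?R
      proof (intro ballI)
        fix T\<^sub>1 T\<^sub>2 assume T: "T\<^sub>1 \<in> cut_sets H\<^sub>1" "T\<^sub>2 \<in> cut_sets H\<^sub>2"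
        then have "insert v (T\<^sub>1 \<union> T\<^sub>2) \<in> cut_sets G" unfolding cut by blast
        with L have "card (components G (insert v (T\<^sub>1 \<union> T\<^sub>2))) = card (insert v (T\<^sub>1 \<union> T\<^sub>2)) + 1"
          by (rule bspec)
        then show "card (components H\<^sub>1 T\<^sub>1) + card (components H\<^sub>2 T\<^sub>2) = (card T\<^sub>1 + 1) + (card T\<^sub>2 + 1)"
          unfolding count[OF T] .
      qed
    next
      assume R: ?R
      show ?L
      proof
        fix S assume "S \<in> cut_sets G"
        then consider "S = {}" | T\<^sub>1 T\<^sub>2 where "S = insert v (T\<^sub>1 \<union> T\<^sub>2)" "T\<^sub>1 \<in> cut_sets H\<^sub>1" "T\<^sub>2 \<in> cut_sets H\<^sub>2"
          unfolding cut by blast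
        then show "card (components G S) = card S + 1"
        proof cases
          case 1
          then show ?thesis by (simp add: card_components_cone_union_empty[OF setting])
        next
          case 2
          from bspec[OF bspec[OF R 2(2)] 2(3)] show ?thesis
            unfolding 2(1) count[OF 2(2,3)] .
        qed
      qed
    qed
  qed
  also have "\<dots> \<longleftrightarrow> (\<forall>T\<^sub>1\<in>cut_sets H\<^sub>1. card (components H\<^sub>1 T\<^sub>1) = card T\<^sub>1 + 1) \<and>
      (\<forall>T\<^sub>2\<in>cut_sets H\<^sub>2. card (components H\<^sub>2 T\<^sub>2) = card T\<^sub>2 + 1)"
    (is "?L \<longleftrightarrow> ?R")
  proof
    assume L: ?L
    show ?R
    proof (intro conjI ballI)
      fix T\<^sub>1 assume "T\<^sub>1 \<in> cut_sets H\<^sub>1"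
      from bspec[OF bspec[OF L this] empty_in_cut_sets]
      show "card (components H\<^sub>1 T\<^sub>1) = card T\<^sub>1 + 1" by (simp add: H2(2))
    next
      fix T\<^sub>2 assume "T\<^sub>2 \<in> cut_sets H\<^sub>2"
      from bspec[OF bspec[OF L empty_in_cut_sets] this]
      show "card (components H\<^sub>2 T\<^sub>2) = card T\<^sub>2 + 1" by (simp add: H1(2))
    qed
  qed simp
  also have "\<dots> \<longleftrightarrow> unmixed (poly_ring K (pverts H\<^sub>1)) (binomial_edge_ideal K H\<^sub>1)
      \<and> unmixed (poly_ring K (pverts H\<^sub>2)) (binomial_edge_ideal K H\<^sub>2)"
    by (simp add: unmixed_binomial_edge_ideal_iff[OF assms(1)] unmixed_binomial_edge_ideal_iff[OF assms(2)]
        H1(2) H2(2))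
  finally show ?thesis by blast
qed

end
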